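(* Let $1\le p<\infty$. A subset $\mathcal{F}$ of $L^p(\mathbb{R}^n)$ is totally bounded if and only if all of the following hold: (i) $\mathcal{F}$ is bounded in $L^p(\mathbb{R}^n)$; (ii) for every $\epsilon>0$ there is some $R$ such that, for every $f\in\mathcal{F}$, \[\int_{|x|>R}|f(x)|^p\,dx<\epsilon^p;\] (iii) for every $\epsilon>0$ there is some $\rho>0$ such that, for every $f\in\mathcal{F}$ and every $y\in\mathbb{R}^n$ with $|y|<\rho$, \[\int_{\mathbb{R}^n}|f(x+y)-f(x)|^p\,dx<\epsilon^p.\]
   Context: $L^p(\mathbb{R}^n)$ is the usual Lebesgue space (real or complex scalars) with respect to Lebesgue measure. A subset of a metric space is totally bounded if for every $\epsilon>0$ it can be covered by finitely many sets of diameter at most $\epsilon$. *)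

theory Defs
  imports "HOL-Analysis.Analysis"
begin

text \<open>
  The scalars are of sort \<open>{real_normed_field, euclidean_space}\<close>, i.e. finite-dimensional
  real fields with a multiplicative Euclidean norm. Up to isometric isomorphism these are
  exactly \<open>real\<close> and \<open>complex\<close>.

  The type \<open>ae_fun\<close> consists of the measurable functions modulo equality almost everywhere;
  \<open>L\<^sup>p\<close> is a subset of it for each exponent. The quotient package provides
  \<open>rep_ae_fun f\<close>, a measurable representative of the class \<open>f\<close>.
\<close>

definition ae_rel ::
    "(real^'n::finite \<Rightarrow> 'k::{real_normed_field, euclidean_space}) \<Rightarrow> (real^'n \<Rightarrow> 'k) \<Rightarrow> bool"
  where "ae_rel f g \<longleftrightarrow>
    f \<in> borel_measurable lebesgue \<and> g \<in> borel_measurable lebesgue \<and> (AE x in lebesgue. f x = g x)"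

lemma part_equivp_ae_rel: "part_equivp ae_rel"
proof (rule part_equivpI)
  show "\<exists>f :: real^'n::finite \<Rightarrow> 'k::{real_normed_field, euclidean_space}. ae_rel f f"
    by (rule exI[of _ "\<lambda>_. 0"]) (simp add: ae_rel_def)
  show "symp ae_rel"
    by (rule sympI) (auto simp: ae_rel_def elim: AE_mp)
  show "transp ae_rel"
  proof (rule transpI)
    fix f g h :: "real^'n::finite \<Rightarrow> 'k::{real_normed_field, euclidean_space}"
    assume *: "ae_rel f g" "ae_rel g h"
    then have "AE x in lebesgue. f x = g x" "AE x in lebesgue. g x = h x"
      by (simp_all add: ae_rel_def)
    then have "AE x in lebesgue. f x = h x"
      by eventually_elim simp
    with * show "ae_rel f h"
      by (simp add: ae_rel_def)
  qed
qed

quotient_type (overloaded) ('k, 'n) ae_fun =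
    "real^'n::finite \<Rightarrow> 'k::{real_normed_field, euclidean_space}" / partial: ae_rel
  by (rule part_equivp_ae_rel)

definition Lp_norm :: "real \<Rightarrow> (real^'n::finite \<Rightarrow> 'k::{real_normed_field, euclidean_space}) \<Rightarrow> real"
  where "Lp_norm p f = (LINT x|lebesgue. norm (f x) powr p) powr (1 / p)"

definition Lp_space :: "real \<Rightarrow> ('k::{real_normed_field, euclidean_space}, 'n::finite) ae_fun set"
  where "Lp_space p = {f. integrable lebesgue (\<lambda>x. norm (rep_ae_fun f x) powr p)}"

definition Lp_dist ::
    "real \<Rightarrow> ('k::{real_normed_field, euclidean_space}, 'n::finite) ae_fun \<Rightarrow> ('k, 'n) ae_fun \<Rightarrow> real"
  where "Lp_dist p f g = Lp_norm p (\<lambda>x. rep_ae_fun f x - rep_ae_fun g x)"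

text \<open>
  Total boundedness of a subset \<open>S\<close> of a metric space with carrier \<open>M\<close> and distance \<open>d\<close>,
  by covers with sets of diameter at most \<open>\<epsilon>\<close>.
\<close>

definition totally_bounded_in :: "'a set \<Rightarrow> ('a \<Rightarrow> 'a \<Rightarrow> real) \<Rightarrow> 'a set \<Rightarrow> bool"
  where "totally_bounded_in M d S \<longleftrightarrow>
    (\<forall>\<epsilon>>0. \<exists>\<U>. finite \<U> \<and> S \<subseteq> \<Union>\<U> \<and> (\<forall>U\<in>\<U>. U \<subseteq> M \<and> (\<forall>x\<in>U. \<forall>y\<in>U. d x y \<le> \<epsilon>)))"


subsection \<open>Agreement with the library notion of total boundedness\<close>

lemma (in Metric_space) totally_bounded_in_iff_mtotally_bounded:
  assumes "S \<subseteq> M"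
  shows "totally_bounded_in M d S \<longleftrightarrow> mtotally_bounded S"
proof
  assume tb: "totally_bounded_in M d S"
  show "mtotally_bounded S"
    unfolding mtotally_bounded_def
  proof (intro allI impI)
    fix e :: real assume e: "e > 0"
    then obtain \<U> where U: "finite \<U>" "S \<subseteq> \<Union>\<U>"
        "\<And>U x y. U \<in> \<U> \<Longrightarrow> x \<in> U \<Longrightarrow> y \<in> U \<Longrightarrow> d x y \<le> e / 2"
      using tb half_gt_zero[OF e] unfolding totally_bounded_in_def by metis
    define c where "c U = (SOME x. x \<in> U \<inter> S)" for U
    have c: "c U \<in> U \<inter> S" if "x \<in> U" "x \<in> S" for U x
      unfolding c_def by (rule someI[of _ x]) (use that in blast)
    define K where "K = c ` {U \<in> \<U>. U \<inter> S \<noteq> {}}"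
    have "finite K"
      using U(1) by (simp add: K_def)
    moreover have "K \<subseteq> S"
      unfolding K_def using c by blast
    moreover have "S \<subseteq> (\<Union>x\<in>K. mball x e)"
    proof
      fix x assume x: "x \<in> S"
      then obtain V where V: "V \<in> \<U>" "x \<in> V"
        using U(2) by blast
      have cV: "c V \<in> V" "c V \<in> S"
        using c[OF V(2) x] by auto
      have "d (c V) x \<le> e / 2"
        using U(3) V cV by blast
      with e x cV assms have "x \<in> mball (c V) e"
        by auto
      moreover have "c V \<in> K"
        unfolding K_def using V x by blast
      ultimately show "x \<in> (\<Union>x\<in>K. mball x e)"
        by blast
    qed
    ultimately show "\<exists>K. finite K \<and> K \<subseteq> S \<and> S \<subseteq> (\<Union>x\<in>K. mball x e)"
      by blast
  qed
next
  assume tb: "mtotally_bounded S"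
  show "totally_bounded_in M d S"
    unfolding totally_bounded_in_def
  proof (intro allI impI)
    fix e :: real assume "e > 0"
    then have e2: "e / 2 > 0" by simp
    obtain K where K: "finite K" "S \<subseteq> (\<Union>x\<in>K. mball x (e / 2))"
      using tb e2 unfolding mtotally_bounded_def by metis
    have "d x y \<le> e" if "x \<in> mball z (e / 2)" "y \<in> mball z (e / 2)" for x y z
    proof -
      have "d x y \<le> d x z + d z y"
        using that by (intro triangle) auto
      with that show ?thesis by (auto simp: commute)
    qed
    with K show "\<exists>\<U>. finite \<U> \<and> S \<subseteq> \<Union>\<U> \<and>
        (\<forall>U\<in>\<U>. U \<subseteq> M \<and> (\<forall>x\<in>U. \<forall>y\<in>U. d x y \<le> e))"
      by (intro exI[of _ "(\<lambda>x. mball x (e / 2)) ` K"]) (auto simp del: in_mball intro: subsetD[OF mball_subset_mspace])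
  qed
qed


subsection \<open>\<open>L\<^sup>p\<close> is a metric space\<close>

lemma rep_ae_fun_measurable [measurable]: "rep_ae_fun f \<in> borel_measurable lebesgue"
  using Quotient3_rep_reflp[OF Quotient3_ae_fun, of f] by (simp add: ae_rel_def)

lemma ae_fun_eq_iff: "f = g \<longleftrightarrow> (AE x in lebesgue. rep_ae_fun f x = rep_ae_fun g x)"
  using Quotient3_rel_rep[OF Quotient3_ae_fun, of f g] by (simp add: ae_rel_def)

lemma rep_abs_ae_fun:
  assumes "f \<in> borel_measurable lebesgue"
  shows "AE x in lebesgue. rep_ae_fun (abs_ae_fun f) x = f x"
  using rep_abs_rsp_left[OF Quotient3_ae_fun, of f f] assms by (simp add: ae_rel_def)

lemma Lp_norm_cong_AE:
  assumes "f \<in> borel_measurable lebesgue" "g \<in> borel_measurable lebesgue"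
    and "AE x in lebesgue. f x = g x"
  shows "Lp_norm p f = Lp_norm p g"
proof -
  have "(LINT x|lebesgue. norm (f x) powr p) = (LINT x|lebesgue. norm (g x) powr p)"
    by (rule integral_cong_AE) (use assms in \<open>auto elim: AE_mp\<close>)
  then show ?thesis by (simp add: Lp_norm_def)
qed

lemma powr_convex_nonneg:
  fixes u v t p :: real
  assumes p: "1 \<le> p" and "0 \<le> u" "0 \<le> v" "0 < t" "t < 1"
  shows "((1 - t) * u + t * v) powr p \<le> (1 - t) * u powr p + t * v powr p"
proof -
  have small: "(s * w) powr p \<le> s * w powr p" if "0 < s" "s < 1" "0 \<le> w" for s w :: real
  proof -
    have "s powr p \<le> s powr 1"
      using that p by (intro powr_mono') auto
    then show ?thesis
      using that by (simp add: powr_mult mult_right_mono)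
  qed
  consider "u = 0" | "v = 0" | "0 < u" "0 < v"
    using assms by linarith
  then show ?thesis
  proof cases
    case 1 then show ?thesis using small[of t v] assms by simp
  next
    case 2 then show ?thesis using small[of "1 - t" u] assms by simp
  next
    case 3 then show ?thesis
      using convex_onD[OF powr_convex[OF p], of t u v] assms by simp
  qed
qed

lemma integrable_powr_add:
  fixes f g :: "real^'n::finite \<Rightarrow> 'k::{real_normed_field, euclidean_space}"
  assumes p: "1 \<le> p"
    and [measurable]: "f \<in> borel_measurable lebesgue" "g \<in> borel_measurable lebesgue"
    and f: "integrable lebesgue (\<lambda>x. norm (f x) powr p)"
    and g: "integrable lebesgue (\<lambda>x. norm (g x) powr p)"
  shows "integrable lebesgue (\<lambda>x. norm (f x + g x) powr p)"
proof (rule Bochner_Integration.integrable_bound)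
  show "integrable lebesgue (\<lambda>x. 2 powr p * (norm (f x) powr p + norm (g x) powr p))"
    using f g by simp
  show "(\<lambda>x. norm (f x + g x) powr p) \<in> borel_measurable lebesgue"
    by measurable
  have "norm (u + v) powr p \<le> 2 powr p * (norm u powr p + norm v powr p)" for u v :: 'k
  proof -
    have "norm (u + v) powr p \<le> (2 * max (norm u) (norm v)) powr p"
      using p norm_triangle_ineq[of u v] by (intro powr_mono2) auto
    also have "\<dots> \<le> 2 powr p * (norm u powr p + norm v powr p)"
      by (auto simp: powr_mult max_def)
    finally show ?thesis .
  qed
  then show "AE x in lebesgue. norm (norm (f x + g x) powr p)
      \<le> norm (2 powr p * (norm (f x) powr p + norm (g x) powr p))"
    by auto
qed

lemma Lp_norm_eq_0:
  assumes "1 \<le> p" "integrable lebesgue (\<lambda>x. norm (f x) powr p)"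
  shows "Lp_norm p f = 0 \<longleftrightarrow> (AE x in lebesgue. f x = 0)"
  using integral_nonneg_eq_0_iff_AE[OF assms(2)] assms(1) by (simp add: Lp_norm_def)

lemma Lp_norm_triangle:
  fixes f g :: "real^'n::finite \<Rightarrow> 'k::{real_normed_field, euclidean_space}"
  assumes p: "1 \<le> p"
    and [measurable]: "f \<in> borel_measurable lebesgue" "g \<in> borel_measurable lebesgue"
    and f: "integrable lebesgue (\<lambda>x. norm (f x) powr p)"
    and g: "integrable lebesgue (\<lambda>x. norm (g x) powr p)"
  shows "Lp_norm p (\<lambda>x. f x + g x) \<le> Lp_norm p f + Lp_norm p g"
proof -
  define a b where "a = Lp_norm p f" and "b = Lp_norm p g"
  have nn: "0 \<le> a" "0 \<le> b"
    by (simp_all add: a_def b_def Lp_norm_def)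
  have ap: "a powr p = (LINT x|lebesgue. norm (f x) powr p)"
    and bp: "b powr p = (LINT x|lebesgue. norm (g x) powr p)"
    using p by (simp_all add: a_def b_def Lp_norm_def powr_powr)
  consider "a = 0" | "b = 0" | "0 < a" "0 < b"
    using nn by linarith
  then show ?thesis
  proof cases
    case 1
    then have "AE x in lebesgue. f x = 0"
      using Lp_norm_eq_0[OF p f] by (simp add: a_def)
    then have "Lp_norm p (\<lambda>x. f x + g x) = Lp_norm p g"
      by (intro Lp_norm_cong_AE) (auto elim: AE_mp)
    with 1 show ?thesis by (simp add: a_def)
  next
    case 2
    then have "AE x in lebesgue. g x = 0"
      using Lp_norm_eq_0[OF p g] by (simp add: b_def)
    then have "Lp_norm p (\<lambda>x. f x + g x) = Lp_norm p f"
      by (intro Lp_norm_cong_AE) (auto elim: AE_mp)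
    with 2 show ?thesis by (simp add: b_def)
  next
    case 3
    define t where "t = b / (a + b)"
    have t: "0 < t" "t < 1" "1 - t = a / (a + b)"
      using 3 by (simp_all add: t_def field_simps)
    have pt: "norm (f x + g x) powr p \<le>
        (a + b) powr p * ((1 - t) * (norm (f x) powr p / a powr p) + t * (norm (g x) powr p / b powr p))" for x
    proof -
      have "norm (f x) + norm (g x) = (a + b) * ((1 - t) * (norm (f x) / a) + t * (norm (g x) / b))"
      proof -
        have "a * (norm (f x) / a) = norm (f x)" "b * (norm (g x) / b) = norm (g x)"
          using 3 by simp_all
        moreover have "(a + b) * (1 - t) = a"
          unfolding t(3) using 3 by simp
        moreover have "(a + b) * t = b"
          unfolding t_def using 3 by simp
        ultimately show ?thesis
          by (metis distrib_left mult.assoc)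
      qed
      moreover have "norm (f x + g x) powr p \<le> (norm (f x) + norm (g x)) powr p"
        using p by (intro powr_mono2) (auto simp: norm_triangle_ineq)
      moreover have "((1 - t) * (norm (f x) / a) + t * (norm (g x) / b)) powr p
          \<le> (1 - t) * (norm (f x) / a) powr p + t * (norm (g x) / b) powr p"
        using 3 t by (intro powr_convex_nonneg p) auto
      ultimately show ?thesis
        using 3 t by (simp add: powr_mult powr_divide mult_left_mono order_trans)
    qed
    have "(LINT x|lebesgue. norm (f x + g x) powr p) \<le> (LINT x|lebesgue.
        (a + b) powr p * ((1 - t) * (norm (f x) powr p / a powr p) + t * (norm (g x) powr p / b powr p)))"
      by (intro integral_mono integrable_powr_add p f g pt) (use f g in auto)
    also have "\<dots> = (a + b) powr p * ((1 - t) * (a powr p / a powr p) + t * (b powr p / b powr p))"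
      using f g by (simp add: ap bp)
    also have "\<dots> = (a + b) powr p"
      using 3 by simp
    finally have "(LINT x|lebesgue. norm (f x + g x) powr p) powr (1 / p) \<le> ((a + b) powr p) powr (1 / p)"
      using p by (intro powr_mono2) (auto intro: integral_nonneg)
    also have "\<dots> = a + b"
      using p nn by (simp add: powr_powr)
    finally show ?thesis by (simp add: Lp_norm_def a_def b_def)
  qed
qed

lemma integrable_Lp_diff:
  assumes "1 \<le> p" "f \<in> Lp_space p" "g \<in> Lp_space p"
  shows "integrable lebesgue (\<lambda>x. norm (rep_ae_fun f x - rep_ae_fun g x) powr p)"
  using integrable_powr_add[of p "rep_ae_fun f" "\<lambda>x. - rep_ae_fun g x"] assms
  by (simp add: Lp_space_def)

lemma Metric_space_Lp:
  assumes p: "1 \<le> p"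
  shows "Metric_space
    (Lp_space p :: ('k::{real_normed_field, euclidean_space}, 'n::finite) ae_fun set) (Lp_dist p)"
proof
  fix f g h :: "('k, 'n) ae_fun"
  show "0 \<le> Lp_dist p f g"
    by (simp add: Lp_dist_def Lp_norm_def)
  show "Lp_dist p f g = Lp_dist p g f"
    by (simp add: Lp_dist_def Lp_norm_def norm_minus_commute)
  assume fg: "f \<in> Lp_space p" "g \<in> Lp_space p"
  show "Lp_dist p f g = 0 \<longleftrightarrow> f = g"
    unfolding Lp_dist_def Lp_norm_eq_0[OF p integrable_Lp_diff[OF p fg]] ae_fun_eq_iff by simp
  assume h: "h \<in> Lp_space p"
  show "Lp_dist p f h \<le> Lp_dist p f g + Lp_dist p g h"
    using Lp_norm_triangle[OF p _ _ integrable_Lp_diff[OF p fg] integrable_Lp_diff[OF p fg(2) h]]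
    by (simp add: Lp_dist_def)
qed


subsection \<open>Independence of the representative\<close>

lemma abs_ae_fun_in_Lp_space_iff:
  assumes [measurable]: "f \<in> borel_measurable lebesgue"
  shows "abs_ae_fun f \<in> Lp_space p \<longleftrightarrow> integrable lebesgue (\<lambda>x. norm (f x) powr p)"
  unfolding Lp_space_def mem_Collect_eq
  by (rule integrable_cong_AE) (use rep_abs_ae_fun[OF assms] in \<open>auto elim: AE_mp\<close>)

lemma tail_integral_cong_AE:
  fixes f g :: "real^'n::finite \<Rightarrow> 'k::{real_normed_field, euclidean_space}"
  assumes [measurable]: "f \<in> borel_measurable lebesgue" "g \<in> borel_measurable lebesgue"
    and "AE x in lebesgue. f x = g x"
  shows "(LINT x:{x. norm x > R}|lebesgue. norm (f x) powr p) =
    (LINT x:{x. norm x > R}|lebesgue. norm (g x) powr p)"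
proof -
  have "open {x :: real^'n. norm x > R}"
    by (intro open_Collect_less continuous_intros)
  then have [measurable]: "{x :: real^'n. norm x > R} \<in> sets lebesgue"
    by auto
  show ?thesis
    unfolding set_lebesgue_integral_def
    by (intro integral_cong_AE) (use assms(3) in \<open>auto elim: AE_mp\<close>)
qed

lemma measurable_lebesgue_translate:
  "(\<lambda>x. x + y) \<in> lebesgue \<rightarrow>\<^sub>M (lebesgue :: (real^'n::finite) measure)"
  using lebesgue_affine_measurable[of "\<lambda>_. 1" y]
  by (simp add: euclidean_representation add.commute)

lemma AE_lebesgue_translate:
  fixes y :: "real^'n::finite"
  assumes "AE x in lebesgue. P x"
  shows "AE x in lebesgue. P (x + y)"
proof -
  obtain N where N: "N \<in> null_sets lebesgue" "{x. \<not> P x} \<subseteq> N"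
    using assms by (auto simp: eventually_ae_filter)
  have "(+) (- y) ` N \<in> null_sets lebesgue"
    using N(1) negligible_translation by (metis negligible_iff_null_sets)
  moreover have "{x. \<not> P (x + y)} \<subseteq> (+) (- y) ` N"
  proof
    fix x assume "x \<in> {x. \<not> P (x + y)}"
    then have "x + y \<in> N" using N(2) by blast
    then show "x \<in> (+) (- y) ` N" by (rule rev_image_eqI) simp
  qed
  ultimately show ?thesis
    by (auto simp: eventually_ae_filter)
qed

lemma translation_integral_cong_AE:
  fixes f g :: "real^'n::finite \<Rightarrow> 'k::{real_normed_field, euclidean_space}"
  assumes f [measurable]: "f \<in> borel_measurable lebesgue" and g [measurable]: "g \<in> borel_measurable lebesgue"
    and eq: "AE x in lebesgue. f x = g x"
  shows "(LINT x|lebesgue. norm (f (x + y) - f x) powr p) =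
    (LINT x|lebesgue. norm (g (x + y) - g x) powr p)"
proof -
  have [measurable]: "(\<lambda>x. f (x + y)) \<in> borel_measurable lebesgue"
      "(\<lambda>x. g (x + y)) \<in> borel_measurable lebesgue"
    using measurable_compose[OF measurable_lebesgue_translate f]
      measurable_compose[OF measurable_lebesgue_translate g] by auto
  have "AE x in lebesgue. norm (f (x + y) - f x) powr p = norm (g (x + y) - g x) powr p"
    using eq AE_lebesgue_translate[OF eq, of y] by eventually_elim simp
  then show ?thesis
    by (intro integral_cong_AE) auto
qed

end

theory Submission
  imports Defs
begin

text \<open>
  To see that the three conditions suffice, cut space into cubes of side \<open>d\<close> and replace \<open>f\<close> by
  the step function whose value on the cube with corner \<open>q\<close> is the sample \<open>f (q + z)\<close>, where
  \<open>z\<close> ranges over one cube. Averaged over \<open>z\<close>, the \<open>p\<close>-th power of the error is at most an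
  average of \<open>\<integral> |f (x + w) - f x|\<^sup>p dx\<close> over \<open>w\<close> in \<open>(-d, d)\<^sup>n\<close>, up to a factor \<open>2\<^sup>n\<close>, by Tonelli's
  theorem; so some \<open>z\<close>, depending on \<open>f\<close>, gives a small error. Cut off outside a large ball, these
  step functions take finitely many values, which boundedness in \<open>L\<^sup>p\<close> confines to a fixed ball
  of scalars; rounding the values leaves finitely many classes. Conversely, the last two
  conditions hold for a single function (dominated convergence, and approximation by
  compactly supported continuous functions) and pass from a finite net to the whole family.
\<close>

subsection \<open>The integral of the \<open>p\<close>-th power\<close>

text \<open>An extended nonnegative integral makes sense without integrability side conditions, so
  Tonelli's theorem and limits apply at once. No root is taken: only smallness matters, and a
  triangle inequality up to a constant is enough for that. Borel functions and \<open>lborel\<close>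
  keep compositions and product measurability simple.\<close>

definition Lp_int :: "real \<Rightarrow> ('a::euclidean_space \<Rightarrow> 'b::real_normed_vector) \<Rightarrow> ennreal"
  where "Lp_int p f = (\<integral>\<^sup>+x. ennreal (norm (f x) powr p) \<partial>lborel)"

lemma Lp_int_minus_commute: "Lp_int p (\<lambda>x. f x - g x) = Lp_int p (\<lambda>x. g x - f x)"
  by (simp add: Lp_int_def norm_minus_commute)

lemma Lp_int_uminus [simp]: "Lp_int p (\<lambda>x. - f x) = Lp_int p f"
  by (simp add: Lp_int_def)

lemma Lp_int_mono:
  assumes "0 \<le> p" "\<And>x. norm (f x) \<le> norm (g x)"
  shows "Lp_int p f \<le> Lp_int p g"
  unfolding Lp_int_def using assms by (intro nn_integral_mono ennreal_leI powr_mono2) auto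

text \<open>Pointwise, |u + v| is at most twice the larger of |u| and |v|. This crude bound replaces
  Minkowski's inequality at the price of the constant \<open>2 powr p\<close>.\<close>

lemma Lp_int_add:
  fixes f g :: "'a::euclidean_space \<Rightarrow> 'b::euclidean_space"
  assumes p: "0 \<le> p"
    and [measurable]: "f \<in> borel_measurable borel" "g \<in> borel_measurable borel"
  shows "Lp_int p (\<lambda>x. f x + g x) \<le> ennreal (2 powr p) * (Lp_int p f + Lp_int p g)"
proof -
  have "norm (u + v) powr p \<le> 2 powr p * (norm u powr p + norm v powr p)" for u v :: 'b
  proof -
    have "norm (u + v) powr p \<le> (2 * max (norm u) (norm v)) powr p"
      using p norm_triangle_ineq[of u v] by (intro powr_mono2) auto
    also have "\<dots> \<le> 2 powr p * (norm u powr p + norm v powr p)"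
      by (auto simp: powr_mult max_def)
    finally show ?thesis .
  qed
  then have "Lp_int p (\<lambda>x. f x + g x) \<le>
      (\<integral>\<^sup>+x. ennreal (2 powr p) * (ennreal (norm (f x) powr p) + ennreal (norm (g x) powr p)) \<partial>lborel)"
    unfolding Lp_int_def
    by (intro nn_integral_mono) (simp flip: ennreal_plus ennreal_mult)
  also have "\<dots> = ennreal (2 powr p) * (Lp_int p f + Lp_int p g)"
    unfolding Lp_int_def by (simp add: nn_integral_cmult nn_integral_add)
  finally show ?thesis .
qed

lemma Lp_int_triangle:
  fixes f g h :: "'a::euclidean_space \<Rightarrow> 'b::euclidean_space"
  assumes p: "0 \<le> p"
    and [measurable]: "f \<in> borel_measurable borel" "g \<in> borel_measurable borel" "h \<in> borel_measurable borel"
  shows "Lp_int p (\<lambda>x. f x - h x) \<le>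
    ennreal (2 powr p) * (Lp_int p (\<lambda>x. f x - g x) + Lp_int p (\<lambda>x. g x - h x))"
  using Lp_int_add[OF p, of "\<lambda>x. f x - g x" "\<lambda>x. g x - h x"] by simp

lemma Lp_int_triangle3:
  fixes f g h k :: "'a::euclidean_space \<Rightarrow> 'b::euclidean_space"
  assumes p: "0 \<le> p"
    and [measurable]: "f \<in> borel_measurable borel" "g \<in> borel_measurable borel"
      "h \<in> borel_measurable borel" "k \<in> borel_measurable borel"
  shows "Lp_int p (\<lambda>x. f x - k x) \<le> ennreal (4 powr p) *
    (Lp_int p (\<lambda>x. f x - g x) + Lp_int p (\<lambda>x. g x - h x) + Lp_int p (\<lambda>x. h x - k x))"
proof -
  \<comment> \<open>The first summand passes through only one of the two triangle inequalities;
    since \<open>2 powr p\<close> is at least 1, it can be inflated so that all three share the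
    factor \<open>4 powr p\<close>.\<close>
  have 1: "1 \<le> ennreal (2 powr p)"
    using p by (simp add: ge_one_powr_ge_zero)
  have 4: "ennreal (4 powr p) = ennreal (2 powr p) * ennreal (2 powr p)"
    using powr_mult[of 2 2 p] by (simp flip: ennreal_mult)
  have "Lp_int p (\<lambda>x. f x - k x) \<le>
      ennreal (2 powr p) * (Lp_int p (\<lambda>x. f x - g x) + Lp_int p (\<lambda>x. g x - k x))"
    by (intro Lp_int_triangle p) auto
  also have "\<dots> \<le> ennreal (2 powr p) * (ennreal (2 powr p) * Lp_int p (\<lambda>x. f x - g x) +
      ennreal (2 powr p) * (Lp_int p (\<lambda>x. g x - h x) + Lp_int p (\<lambda>x. h x - k x)))"
    using mult_right_mono[OF 1, of "Lp_int p (\<lambda>x. f x - g x)"]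
    by (intro mult_left_mono add_mono Lp_int_triangle p) auto
  finally show ?thesis
    by (simp add: 4 algebra_simps)
qed

lemma nn_integral_lborel_translate:
  fixes y :: "'a::euclidean_space"
  assumes "f \<in> borel_measurable borel"
  shows "(\<integral>\<^sup>+x. f (x + y) \<partial>lborel) = (\<integral>\<^sup>+x. f x \<partial>lborel)"
proof -
  have "(\<integral>\<^sup>+x. f x \<partial>lborel) = (\<integral>\<^sup>+x. f x \<partial>distr lborel borel ((+) y))"
    by (simp add: lborel_distr_plus)
  also have "\<dots> = (\<integral>\<^sup>+x. f (x + y) \<partial>lborel)"
    using assms by (subst nn_integral_distr) (auto simp: add.commute)
  finally show ?thesis ..
qed

lemma Lp_int_translate:
  fixes f :: "'a::euclidean_space \<Rightarrow> 'b::euclidean_space"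
  assumes [measurable]: "f \<in> borel_measurable borel"
  shows "Lp_int p (\<lambda>x. f (x + y)) = Lp_int p f"
  unfolding Lp_int_def by (rule nn_integral_lborel_translate) measurable

lemma Lp_int_indicator_bound:
  assumes "0 \<le> p" "\<And>x. x \<in> A \<Longrightarrow> norm (f x) \<le> M" "\<And>x. x \<notin> A \<Longrightarrow> f x = 0" "A \<in> sets borel"
  shows "Lp_int p f \<le> ennreal (M powr p) * emeasure lborel A"
proof -
  have "Lp_int p f \<le> (\<integral>\<^sup>+x. ennreal (M powr p) * indicator A x \<partial>lborel)"
    unfolding Lp_int_def using assms
    by (intro nn_integral_mono) (auto simp: indicator_def intro!: ennreal_leI powr_mono2)
  also have "\<dots> = ennreal (M powr p) * emeasure lborel A"
    using assms by (simp add: nn_integral_cmult_indicator)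
  finally show ?thesis .
qed

subsection \<open>Sampling on a cubical grid\<close>

text \<open>The lower corner of the half-open cube of side \<open>d\<close> that contains
  \<open>x\<close>: every coordinate is rounded down to a multiple of \<open>d\<close>.\<close>

definition grid :: "real \<Rightarrow> 'a::euclidean_space \<Rightarrow> 'a"
  where "grid d x = (\<Sum>b\<in>Basis. (d * of_int \<lfloor>x \<bullet> b / d\<rfloor>) *\<^sub>R b)"

lemma grid_measurable [measurable]: "grid d \<in> borel_measurable borel"
  unfolding grid_def by measurable

lemma grid_inner: "b \<in> Basis \<Longrightarrow> grid d x \<bullet> b = d * of_int \<lfloor>x \<bullet> b / d\<rfloor>"
  by (simp add: grid_def)

lemma grid_bounds:
  assumes "0 < d" "b \<in> Basis"
  shows "grid d x \<bullet> b \<le> x \<bullet> b" "x \<bullet> b < grid d x \<bullet> b + d"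
proof -
  have "of_int \<lfloor>x \<bullet> b / d\<rfloor> \<le> x \<bullet> b / d" "x \<bullet> b / d < of_int \<lfloor>x \<bullet> b / d\<rfloor> + 1"
    by linarith+
  with assms show "grid d x \<bullet> b \<le> x \<bullet> b" "x \<bullet> b < grid d x \<bullet> b + d"
    by (simp_all add: grid_inner pos_le_divide_eq pos_divide_less_eq algebra_simps del: of_int_floor_le)
qed

lemma grid_eqI:
  assumes d: "0 < d" and x: "x \<in> box (grid d a) (grid d a + d *\<^sub>R One)"
  shows "grid d x = grid d a"
proof (rule euclidean_eqI)
  fix b :: 'a assume b: "b \<in> Basis"
  have "\<lfloor>x \<bullet> b / d\<rfloor> = \<lfloor>a \<bullet> b / d\<rfloor>"
    using x b d by (intro floor_unique) (auto simp: mem_box grid_inner inner_add_left field_simps dest!: bspec[of _ _ b])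
  then show "grid d x \<bullet> b = grid d a \<bullet> b"
    using b by (simp add: grid_inner)
qed

text \<open>A corner is determined by one integer per coordinate, and on a ball these integers lie
  in a fixed interval. Hence a cut-off step function has finitely many values.\<close>

lemma finite_grid_cball:
  assumes d: "0 < d"
  shows "finite (grid d ` cball (0::'a::euclidean_space) R)"
proof -
  define I where "I = {- \<lceil>R / d\<rceil> - 1 .. \<lceil>R / d\<rceil>}"
  have "grid d ` cball 0 R \<subseteq>
      (\<lambda>k. \<Sum>b\<in>Basis. (d * of_int (k b)) *\<^sub>R b) ` (Basis \<rightarrow>\<^sub>E I :: ('a \<Rightarrow> int) set)"
  proof
    fix q assume "q \<in> grid d ` cball (0::'a) R"
    then obtain x where x: "norm x \<le> R" "q = grid d x" by auto
    have "\<lfloor>x \<bullet> b / d\<rfloor> \<in> I" if "b \<in> Basis" for b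
    proof -
      have "\<bar>x \<bullet> b\<bar> \<le> R"
        using Basis_le_norm[OF that, of x] x by linarith
      then have "- (R / d) \<le> x \<bullet> b / d" "x \<bullet> b / d \<le> R / d"
        using d by (auto simp: field_simps)
      then show ?thesis
        unfolding I_def atLeastAtMost_iff by linarith
    qed
    then show "q \<in> (\<lambda>k. \<Sum>b\<in>Basis. (d * of_int (k b)) *\<^sub>R b) ` (Basis \<rightarrow>\<^sub>E I)"
      by (intro image_eqI[of _ _ "\<lambda>b\<in>Basis. \<lfloor>x \<bullet> b / d\<rfloor>"]) (auto simp: x grid_def intro!: sum.cong)
  qed
  then show ?thesis
    by (rule finite_subset) (auto simp: I_def intro!: finite_imageI finite_PiE)
qed

lemma emeasure_cube:
  assumes "0 \<le> d"
  shows "emeasure lborel (box a (a + d *\<^sub>R One :: 'a::euclidean_space)) = ennreal (d ^ DIM('a))"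
  using assms by (subst emeasure_lborel_box) (auto simp: inner_add_left)

text \<open>An averaging argument. If every \<open>z\<close> were bad, integrating over the cube
  \<open>Q\<close> would make the total error at least 2 * 2^n * c * |Q|, with n =
  \<open>DIM('a)\<close>. Tonelli's theorem rewrites this total in terms of translates by vectors of
  \<open>D\<close>, which bounds it by c * |D| = 2^n * c * |Q|.\<close>

lemma exists_good_sample:
  fixes f :: "'a::euclidean_space \<Rightarrow> 'b::euclidean_space"
  assumes d: "0 < d" and c: "0 < c"
    and [measurable]: "f \<in> borel_measurable borel"
    and shift: "\<And>y. y \<in> box (- d *\<^sub>R One) (d *\<^sub>R One) \<Longrightarrow> Lp_int p (\<lambda>x. f (x + y) - f x) \<le> ennreal c"
  shows "\<exists>z. Lp_int p (\<lambda>x. f x - f (grid d x + z)) \<le> ennreal (2 * 2 ^ DIM('a) * c)"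
proof (rule ccontr)
  define Q :: "'a set" where "Q = box 0 (d *\<^sub>R One)"
  define D :: "'a set" where "D = box (- d *\<^sub>R One) (d *\<^sub>R One)"
  define k where "k x y = ennreal (norm (f y - f x) powr p)" for x y
  have [measurable]: "case_prod k \<in> borel_measurable (lborel \<Otimes>\<^sub>M lborel)"
    unfolding k_def by (measurable; simp)
  have [measurable]: "Q \<in> sets borel" "D \<in> sets borel"
    by (auto simp: Q_def D_def)
  assume "\<not> ?thesis"
  then have big: "ennreal (2 * 2 ^ DIM('a) * c) < (\<integral>\<^sup>+x. k x (grid d x + z) \<partial>lborel)" for z
    by (auto simp: not_le Lp_int_def k_def norm_minus_commute)
  have mQ: "emeasure lborel Q = ennreal (d ^ DIM('a))"
    unfolding Q_def using emeasure_cube[of d 0] d by simp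
  have mD: "emeasure lborel D = ennreal (2 ^ DIM('a) * d ^ DIM('a))"
    unfolding D_def using emeasure_cube[of "2 * d" "- d *\<^sub>R One"] d
    by (simp add: power_mult_distrib algebra_simps flip: scaleR_add_left)
  have "ennreal (2 * 2 ^ DIM('a) * c) * emeasure lborel Q = (\<integral>\<^sup>+z. ennreal (2 * 2 ^ DIM('a) * c) * indicator Q z \<partial>lborel)"
    by (simp add: nn_integral_cmult_indicator)
  also have "\<dots> \<le> (\<integral>\<^sup>+z. (\<integral>\<^sup>+x. indicator Q z * k x (grid d x + z) \<partial>lborel) \<partial>lborel)"
    using big by (intro nn_integral_mono) (auto simp: indicator_def intro: less_imp_le)
  also have "\<dots> = (\<integral>\<^sup>+x. (\<integral>\<^sup>+z. indicator Q z * k x (grid d x + z) \<partial>lborel) \<partial>lborel)"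
    by (rule lborel_pair.Fubini') measurable
  also have "\<dots> \<le> (\<integral>\<^sup>+x. (\<integral>\<^sup>+w. indicator D w * k x (x + w) \<partial>lborel) \<partial>lborel)"
  proof (rule nn_integral_mono)
    fix x
    \<comment> \<open>Substituting \<open>z = w + (x - grid d x)\<close> turns the sample point
      \<open>grid d x + z\<close> into \<open>x + w\<close>. The offset \<open>x - grid d x\<close>
      has coordinates in [0, d), so \<open>z\<close> in \<open>Q\<close> forces \<open>w\<close>
      into \<open>D\<close>.\<close>
    have "(\<integral>\<^sup>+z. indicator Q z * k x (grid d x + z) \<partial>lborel) =
        (\<integral>\<^sup>+w. indicator Q (w + (x - grid d x)) * k x (grid d x + (w + (x - grid d x))) \<partial>lborel)"
      by (subst nn_integral_lborel_translate) (auto)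
    also have "\<dots> \<le> (\<integral>\<^sup>+w. indicator D w * k x (x + w) \<partial>lborel)"
    proof (intro nn_integral_mono)
      fix w
      have "w \<in> D" if "w + (x - grid d x) \<in> Q"
        unfolding D_def mem_box
      proof
        fix b :: 'a assume b: "b \<in> Basis"
        have "0 < (w + (x - grid d x)) \<bullet> b" "(w + (x - grid d x)) \<bullet> b < d"
          using that b unfolding Q_def mem_box by (auto dest!: bspec[of _ _ b])
        then show "(- d *\<^sub>R One) \<bullet> b < w \<bullet> b \<and> w \<bullet> b < (d *\<^sub>R One) \<bullet> b"
          using grid_bounds[OF d b, of x] b by (simp add: inner_add_left inner_diff_left)
      qed
      then show "indicator Q (w + (x - grid d x)) * k x (grid d x + (w + (x - grid d x)))
          \<le> indicator D w * k x (x + w)"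
        by (auto simp: indicator_def add_ac)
    qed
    finally show "(\<integral>\<^sup>+z. indicator Q z * k x (grid d x + z) \<partial>lborel) \<le> (\<integral>\<^sup>+w. indicator D w * k x (x + w) \<partial>lborel)" .
  qed
  also have "\<dots> = (\<integral>\<^sup>+w. (\<integral>\<^sup>+x. indicator D w * k x (x + w) \<partial>lborel) \<partial>lborel)"
    by (rule lborel_pair.Fubini'[symmetric]) measurable
  also have "\<dots> \<le> (\<integral>\<^sup>+w. ennreal c * indicator D w \<partial>lborel)"
    using shift by (intro nn_integral_mono) (auto simp: indicator_def k_def D_def Lp_int_def)
  also have "\<dots> = ennreal c * emeasure lborel D"
    by (simp add: nn_integral_cmult_indicator)
  \<comment> \<open>The chain has only non-strict inequalities; the extra factor 2 in the bound
    makes it contradictory, because \<open>c\<close> and |Q| are positive and finite.\<close>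
  finally show False
    using c d by (simp add: mQ mD flip: ennreal_mult)
qed

text \<open>The step function is constant on the cell of \<open>a\<close>, so this cell alone
  contributes the left-hand side to the integral. An integral bound thus becomes a bound for each
  sampled value.\<close>

lemma sample_bound:
  fixes g :: "'a::euclidean_space \<Rightarrow> 'b::euclidean_space"
  assumes d: "0 < d" and [measurable]: "g \<in> borel_measurable borel"
  shows "ennreal (norm (g (grid d a)) powr p * d ^ DIM('a)) \<le> Lp_int p (\<lambda>x. g (grid d x))"
proof -
  define Q where "Q = box (grid d a) (grid d a + d *\<^sub>R One)"
  have "ennreal (norm (g (grid d a)) powr p * d ^ DIM('a)) =
      ennreal (norm (g (grid d a)) powr p) * emeasure lborel Q"
    unfolding Q_def using emeasure_cube[of d "grid d a"] d by (simp add: ennreal_mult)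
  also have "\<dots> = (\<integral>\<^sup>+x. ennreal (norm (g (grid d a)) powr p) * indicator Q x \<partial>lborel)"
    by (simp add: Q_def nn_integral_cmult_indicator)
  also have "\<dots> \<le> Lp_int p (\<lambda>x. g (grid d x))"
    unfolding Lp_int_def
    by (intro nn_integral_mono) (auto simp: indicator_def Q_def dest: grid_eqI[OF d])
  finally show ?thesis .
qed

text \<open>Each \<open>h i\<close> is compared with a cut-off sampled step function
  \<open>s i\<close>, and two indices are put in one class when the values of their step functions
  round to the same points. The path from \<open>h i\<close> through \<open>s i\<close> and
  \<open>s j\<close> to \<open>h j\<close> costs \<open>e'\<close> three times. The family is
  indexed so that it can consist of chosen representatives of classes of functions.\<close>

lemma totally_bounded_of_samples:
  fixes h :: "'i \<Rightarrow> 'a::euclidean_space \<Rightarrow> 'b::euclidean_space"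
  assumes p: "1 \<le> p" and e: "0 < e"
    and [measurable]: "\<And>i. h i \<in> borel_measurable borel"
    and bound: "\<And>i. i \<in> F \<Longrightarrow> Lp_int p (h i) \<le> ennreal B"
    and tail: "\<And>c. 0 < c \<Longrightarrow>
      \<exists>R. \<forall>i\<in>F. Lp_int p (\<lambda>x. indicator {x. norm x > R} x *\<^sub>R h i x) \<le> ennreal c"
    and shift: "\<And>c. 0 < c \<Longrightarrow>
      \<exists>\<rho>>0. \<forall>i\<in>F. \<forall>y. norm y < \<rho> \<longrightarrow> Lp_int p (\<lambda>x. h i (x + y) - h i x) \<le> ennreal c"
  shows "\<exists>\<U>. finite \<U> \<and> F \<subseteq> \<Union>\<U> \<and>
    (\<forall>U\<in>\<U>. U \<subseteq> F \<and> (\<forall>i\<in>U. \<forall>j\<in>U. Lp_int p (\<lambda>x. h i x - h j x) \<le> ennreal e))"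
proof -
  define e' where "e' = e / (3 * 4 powr p)"
  have e': "0 < e'" "3 * 4 powr p * e' = e"
    using e by (simp_all add: e'_def)
  \<comment> \<open>Makes the bound \<open>2 * 2 ^ DIM('a) * c\<close> for a good sample equal to
    \<open>e' / 2\<close>; the other half of \<open>e'\<close> pays for the tail.\<close>
  define c where "c = e' / (4 * 2 ^ DIM('a))"
  have c: "0 < c" "2 * 2 ^ DIM('a) * c = e' / 2"
    using e' by (simp_all add: c_def)
  obtain R where R: "\<And>i. i \<in> F \<Longrightarrow>
      Lp_int p (\<lambda>x. indicator {x. norm x > R} x *\<^sub>R h i x) \<le> ennreal (e' / 2)"
    using tail[of "e' / 2"] e' by auto
  obtain \<rho> where \<rho>: "0 < \<rho>" "\<And>i y. i \<in> F \<Longrightarrow> norm y < \<rho> \<Longrightarrow>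
      Lp_int p (\<lambda>x. h i (x + y) - h i x) \<le> ennreal c"
    using shift[OF c(1)] by blast
  \<comment> \<open>A vector with all coordinates at most \<open>d\<close> in absolute value has
    l1-norm at most \<open>DIM('a) * d = \<rho> / 2\<close>, so every shift in the box is
    admissible.\<close>
  define d where "d = \<rho> / (2 * DIM('a))"
  have d: "0 < d" using \<rho> by (simp add: d_def)
  have small: "norm y < \<rho>" if "y \<in> box (- d *\<^sub>R One) (d *\<^sub>R One)" for y :: 'a
  proof -
    have "norm y \<le> (\<Sum>b\<in>Basis. \<bar>y \<bullet> b\<bar>)"
      by (rule norm_le_l1)
    also have "\<dots> \<le> (\<Sum>b\<in>(Basis::'a set). d)"
      using that by (intro sum_mono) (auto simp: mem_box abs_le_iff intro!: less_imp_le dest!: bspec)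
    also have "\<dots> < \<rho>"
      using \<rho> by (simp add: d_def)
    finally show ?thesis .
  qed
  have "\<exists>z. Lp_int p (\<lambda>x. h i x - h i (grid d x + z)) \<le> ennreal (e' / 2)" if "i \<in> F" for i
    using exists_good_sample[OF d c(1), of "h i" p] \<rho>(2)[OF that] small by (simp add: c(2))
  then obtain z where z: "\<And>i. i \<in> F \<Longrightarrow> Lp_int p (\<lambda>x. h i x - h i (grid d x + z i)) \<le> ennreal (e' / 2)"
    by metis
  define s where "s i x = indicator (cball 0 R) x *\<^sub>R h i (grid d x + z i)" for i x
  have [measurable]: "(\<lambda>x. h i (grid d x + z i)) \<in> borel_measurable borel" for i
    by (rule measurable_compose[of "\<lambda>x. grid d x + z i" borel borel "h i"]) auto
  have [measurable]: "s i \<in> borel_measurable borel" for i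
    unfolding s_def by (intro borel_measurable_scaleR borel_measurable_indicator) auto
  have s: "Lp_int p (\<lambda>x. h i x - s i x) \<le> ennreal e'" if i: "i \<in> F" for i
  proof -
    \<comment> \<open>Inside the ball the error is the sampling error, outside it is
      \<open>h i x\<close> itself. At each point one of the two summands bounds it, so no factor
      \<open>2 powr p\<close> appears.\<close>
    have "Lp_int p (\<lambda>x. h i x - s i x) \<le>
        (\<integral>\<^sup>+x. ennreal (norm (h i x - h i (grid d x + z i)) powr p) +
          ennreal (norm (indicator {x. norm x > R} x *\<^sub>R h i x) powr p) \<partial>lborel)"
      unfolding Lp_int_def by (intro nn_integral_mono) (auto simp: s_def indicator_def)
    also have "\<dots> = Lp_int p (\<lambda>x. h i x - h i (grid d x + z i)) +
        Lp_int p (\<lambda>x. indicator {x. norm x > R} x *\<^sub>R h i x)"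
      unfolding Lp_int_def by (rule nn_integral_add) measurable
    also have "\<dots> \<le> ennreal (e' / 2) + ennreal (e' / 2)"
      using R z i by (intro add_mono) auto
    also have "\<dots> = ennreal e'"
      using e' by (simp flip: ennreal_plus)
    finally show ?thesis .
  qed
  \<comment> \<open>\<open>ennreal B\<close> is 0 for negative \<open>B\<close>, hence the maximum
    with 0. \<open>B'\<close> bounds the integral of the full, not cut-off, sampled function;
    dividing by the volume of a cell and taking the root gives the bound \<open>M\<close> on single
    values.\<close>
  define B' where "B' = 2 powr p * (max B 0 + e' / 2)"
  define M where "M = (B' / d ^ DIM('a)) powr (1 / p)"
  have M: "norm (h i (grid d a + z i)) \<le> M" if i: "i \<in> F" for i a
  proof -
    have "ennreal (norm (h i (grid d a + z i)) powr p * d ^ DIM('a)) \<le> Lp_int p (\<lambda>x. h i (grid d x + z i))"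
      by (rule sample_bound[OF d, of "\<lambda>x. h i (x + z i)"]) measurable
    also have "\<dots> \<le> ennreal (2 powr p) * (Lp_int p (\<lambda>x. h i (grid d x + z i) - h i x) + Lp_int p (h i))"
      using Lp_int_triangle[of p "\<lambda>x. h i (grid d x + z i)" "h i" "\<lambda>x. 0"] p by simp
    also have "\<dots> \<le> ennreal (2 powr p) * (ennreal (e' / 2) + ennreal (max B 0))"
      using z[OF i] order_trans[OF bound[OF i] ennreal_leI[of B "max B 0"]]
      by (intro mult_left_mono add_mono) (auto simp: Lp_int_minus_commute[of p "h i"])
    also have "\<dots> = ennreal B'"
      using e' by (simp add: B'_def add.commute flip: ennreal_plus ennreal_mult)
    finally have "norm (h i (grid d a + z i)) powr p * d ^ DIM('a) \<le> B'"
      using e' by (subst (asm) ennreal_le_iff) (auto simp: B'_def)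
    then have "norm (h i (grid d a + z i)) powr p \<le> B' / d ^ DIM('a)"
      using d by (simp add: field_simps)
    then have "(norm (h i (grid d a + z i)) powr p) powr (1 / p) \<le> M"
      unfolding M_def using p by (intro powr_mono2) auto
    then show ?thesis using p by (simp add: powr_powr)
  qed
  define V where "V = measure lborel (cball (0::'a) R)"
  have V: "emeasure lborel (cball (0::'a) R) = ennreal V"
    unfolding V_def by (rule emeasure_eq_ennreal_measure) (use emeasure_bounded_finite[of "cball (0::'a) R"] in auto)
  have V0: "0 \<le> V" by (simp add: V_def)
  \<comment> \<open>Solves \<open>(2 * \<eta>) powr p = e' / (V + 1)\<close>; the denominator
    \<open>V + 1\<close> stays positive even if the ball is a null set.\<close>
  define \<eta> where "\<eta> = (e' / (V + 1)) powr (1 / p) / 2"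
  have \<eta>: "0 < \<eta>" "(2 * \<eta>) powr p * V \<le> e'"
  proof -
    show "0 < \<eta>" using e' V0 by (simp add: \<eta>_def)
    have "(2 * \<eta>) powr p = e' / (V + 1)"
      using p e' V0 by (simp add: \<eta>_def powr_powr)
    then show "(2 * \<eta>) powr p * V \<le> e'"
      using e' V0 by (simp add: pos_divide_le_eq mult_left_mono)
  qed
  obtain C where C: "finite C" "cball (0::'b) M \<subseteq> (\<Union>w\<in>C. ball w \<eta>)"
    using compact_cball[of "0::'b" M] \<eta>(1) unfolding compact_eq_totally_bounded by blast
  define P where "P = grid d ` cball (0::'a) R"
  have "\<exists>w\<in>C. dist w (h i (q + z i)) < \<eta>" if "i \<in> F" "q \<in> P" for i q
    using M[OF that(1)] that(2) C(2) by (force simp: P_def)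
  then obtain key where key: "\<And>i q. i \<in> F \<Longrightarrow> q \<in> P \<Longrightarrow> key i q \<in> C \<and> dist (key i q) (h i (q + z i)) < \<eta>"
    by metis
  \<comment> \<open>The values \<open>key i q\<close> are the rounded samples. Restricting to the
    finite set \<open>P\<close> of corners makes the label an element of the finite set
    \<open>P \<rightarrow>\<^sub>E C\<close>, so there are finitely many classes.\<close>
  define U where "U k = {i \<in> F. restrict (key i) P = k}" for k
  have close: "Lp_int p (\<lambda>x. h i x - h j x) \<le> ennreal e" if "i \<in> U k" "j \<in> U k" for i j k
  proof -
    have "restrict (key i) P = restrict (key j) P"
      using that by (auto simp: U_def)
    then have eq: "key i q = key j q" if "q \<in> P" for q
      using that by (metis restrict_apply')
    have ij: "i \<in> F" "j \<in> F"
      using that by (auto simp: U_def)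
    have "Lp_int p (\<lambda>x. s i x - s j x) \<le> ennreal ((2 * \<eta>) powr p) * emeasure lborel (cball (0::'a) R)"
    proof (rule Lp_int_indicator_bound)
      fix x :: 'a assume x: "x \<in> cball 0 R"
      then have q: "grid d x \<in> P" by (auto simp: P_def)
      \<comment> \<open>Both samples lie within \<open>\<eta>\<close> of the same point of
        \<open>C\<close>. The offsets \<open>z i\<close> and \<open>z j\<close> may differ: only the
        sampled values are compared.\<close>
      have "dist (h i (grid d x + z i)) (h j (grid d x + z j)) \<le> 2 * \<eta>"
        using key[OF ij(1) q] key[OF ij(2) q] eq[OF q]
          dist_triangle3[of "h i (grid d x + z i)" "h j (grid d x + z j)" "key i (grid d x)"]
        by simp
      with x show "norm (s i x - s j x) \<le> 2 * \<eta>"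
        by (simp add: s_def dist_norm)
    qed (use p in \<open>auto simp: s_def\<close>)
    also have "\<dots> \<le> ennreal e'"
      using \<eta> V0 by (simp add: V ennreal_leI flip: ennreal_mult)
    finally have "Lp_int p (\<lambda>x. s i x - s j x) \<le> ennreal e'" .
    moreover have "Lp_int p (\<lambda>x. h i x - h j x) \<le> ennreal (4 powr p) *
        (Lp_int p (\<lambda>x. h i x - s i x) + Lp_int p (\<lambda>x. s i x - s j x) + Lp_int p (\<lambda>x. s j x - h j x))"
      using p by (intro Lp_int_triangle3) auto
    ultimately have "Lp_int p (\<lambda>x. h i x - h j x) \<le> ennreal (4 powr p) * (ennreal e' + ennreal e' + ennreal e')"
      using s[OF ij(1)] s[OF ij(2)]
      by (elim order_trans) (intro mult_left_mono add_mono, auto simp: Lp_int_minus_commute[of p "h j"])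
    also have "\<dots> = ennreal e"
      using e' by (simp add: algebra_simps flip: ennreal_plus ennreal_mult)
    finally show ?thesis .
  qed
  have "finite (P \<rightarrow>\<^sub>E C)"
    using C finite_grid_cball[OF d] by (auto simp: P_def intro: finite_PiE)
  moreover have "F \<subseteq> \<Union> (U ` (P \<rightarrow>\<^sub>E C))"
  proof
    fix i assume "i \<in> F"
    then have "i \<in> U (restrict (key i) P)" "restrict (key i) P \<in> P \<rightarrow>\<^sub>E C"
      using key by (auto simp: U_def)
    then show "i \<in> \<Union> (U ` (P \<rightarrow>\<^sub>E C))" by blast
  qed
  ultimately show ?thesis
    using close by (intro exI[of _ "U ` (P \<rightarrow>\<^sub>E C)"]) (auto simp: U_def)
qed

subsection \<open>Tails and translations of a single function\<close>

lemma Lp_int_tendsto_0: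
  fixes f :: "nat \<Rightarrow> 'a::euclidean_space \<Rightarrow> 'b::euclidean_space"
  assumes p: "0 < p" and [measurable]: "\<And>n. f n \<in> borel_measurable borel"
    and lim: "AE x in lborel. (\<lambda>n. f n x) \<longlonglongrightarrow> 0"
    and dom: "\<And>n x. norm (f n x) \<le> norm (g x)" "g \<in> borel_measurable borel" "Lp_int p g < \<infinity>"
  shows "(\<lambda>n. Lp_int p (f n)) \<longlonglongrightarrow> 0"
proof -
  note [measurable] = dom(2)
  have "(\<lambda>n. \<integral>\<^sup>+x. ennreal (norm (f n x) powr p) \<partial>lborel) \<longlonglongrightarrow> (\<integral>\<^sup>+x. 0 \<partial>(lborel :: 'a measure))"
  proof (rule nn_integral_dominated_convergence)
    show "AE x in lborel. (\<lambda>n. ennreal (norm (f n x) powr p)) \<longlonglongrightarrow> 0"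
      using lim
    proof eventually_elim
      case (elim x)
      then have "(\<lambda>n. norm (f n x) powr p) \<longlonglongrightarrow> 0 powr p"
        using p tendsto_norm_zero by (intro tendsto_powr2) (auto intro!: tendsto_powr2)
      then show ?case
        using p by (simp flip: ennreal_0 add: tendsto_ennrealI)
    qed
    show "(\<integral>\<^sup>+x. ennreal (norm (g x) powr p) \<partial>lborel) < \<infinity>"
      using dom(3) by (simp add: Lp_int_def)
    show "AE x in lborel. ennreal (norm (f n x) powr p) \<le> ennreal (norm (g x) powr p)" for n
      using dom(1) p by (auto intro!: ennreal_leI powr_mono2)
  qed measurable
  then show ?thesis by (simp add: Lp_int_def)
qed

lemma Lp_int_tail_tendsto_0:
  fixes f :: "'a::euclidean_space \<Rightarrow> 'b::euclidean_space"
  assumes p: "0 < p" and [measurable]: "f \<in> borel_measurable borel" and "Lp_int p f < \<infinity>"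
  shows "(\<lambda>n. Lp_int p (\<lambda>x. indicator {x. norm x > real n} x *\<^sub>R f x)) \<longlonglongrightarrow> 0"
proof (rule Lp_int_tendsto_0[OF p _ _ _ _ assms(3)])
  have "(\<lambda>n. indicator {x. norm x > real n} x *\<^sub>R f x) \<longlonglongrightarrow> 0" for x
  proof (rule tendsto_eventually)
    obtain N where "norm x \<le> real N" using real_arch_simple by blast
    then show "\<forall>\<^sub>F n in sequentially. indicator {x. norm x > real n} x *\<^sub>R f x = 0"
      by (intro eventually_sequentiallyI[of N]) (auto simp: indicator_def)
  qed
  then show "AE x in lborel. (\<lambda>n. indicator {x. norm x > real n} x *\<^sub>R f x) \<longlonglongrightarrow> 0"
    by simp
qed (auto simp: indicator_def)

text \<open>Measurability gives continuous functions \<open>u n\<close> that converge to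
  \<open>f\<close> almost everywhere, but without any control of size or support. Clipping their
  values and multiplying by a cut-off function keeps continuity and the limit, and supplies a
  majorant for dominated convergence.\<close>

lemma Lp_int_approx_continuous_bounded:
  fixes f :: "'a::euclidean_space \<Rightarrow> 'b::euclidean_space"
  assumes p: "1 \<le> p" and e: "0 < (e::ennreal)" and [measurable]: "f \<in> borel_measurable borel"
    and M: "0 < M" "\<And>x. norm (f x) \<le> M" and R: "\<And>x. R < norm x \<Longrightarrow> f x = 0"
  obtains g :: "'a \<Rightarrow> 'b" where "continuous_on UNIV g" "\<And>x. R + 1 < norm x \<Longrightarrow> g x = 0"
    "Lp_int p (\<lambda>x. f x - g x) < e"
proof -
  have "f \<in> borel_measurable (lebesgue_on UNIV)"
    by (simp add: lebesgue_on_UNIV_eq measurable_completion)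
  then have "f measurable_on UNIV"
    by (subst measurable_on_iff_borel_measurable) auto
  then obtain N u where N: "negligible N" and u: "\<And>n. continuous_on UNIV (u n)"
      "\<And>x. x \<notin> N \<Longrightarrow> (\<lambda>n::nat. u n x) \<longlonglongrightarrow> f x"
    unfolding measurable_on_def by auto
  \<comment> \<open>The radial retraction onto the ball of radius \<open>M\<close>. The function
    \<open>\<phi>\<close> below is 1 on the ball of radius \<open>R\<close> and falls linearly to 0
    at radius \<open>R + 1\<close>.\<close>
  define clip where "clip v = v /\<^sub>R max 1 (norm v / M)" for v :: 'b
  define \<phi> where "\<phi> x = max 0 (min 1 (R + 1 - norm x))" for x :: 'a
  define g where "g n x = \<phi> x *\<^sub>R clip (u n x)" for n x
  have clip_cont: "continuous_on UNIV clip"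
    unfolding clip_def using M by (intro continuous_intros) (auto simp: max_def)
  have clip_bd: "norm (clip v) \<le> M" for v
    using M by (auto simp: clip_def max_def field_simps)
  have clip_id: "clip v = v" if "norm v \<le> M" for v
    using M that by (simp add: clip_def max_def field_simps)
  have \<phi>f: "\<phi> x *\<^sub>R clip (f x) = f x" for x
    using R[of x] M(2)[of x] by (cases "norm x \<le> R") (auto simp: \<phi>_def clip_id)
  have g_cont: "continuous_on UNIV (g n)" for n
    unfolding g_def \<phi>_def
    by (intro continuous_intros continuous_on_compose2[OF clip_cont u(1)]) auto
  then have [measurable]: "g n \<in> borel_measurable borel" for n
    by (rule borel_measurable_continuous_onI)
  have g0: "g n x = 0" if "R + 1 < norm x" for n x
    using that by (simp add: g_def \<phi>_def)
  have "(\<lambda>n. Lp_int p (\<lambda>x. f x - g n x)) \<longlonglongrightarrow> 0"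
  proof (rule Lp_int_tendsto_0[where g = "\<lambda>x. indicator (cball 0 (R + 1)) x *\<^sub>R (2 * M)"])
    have "AE x in lebesgue. x \<notin> N"
      using N by (simp add: AE_not_in negligible_iff_null_sets)
    then have "AE x in lborel. x \<notin> N"
      by (simp add: AE_completion_iff)
    then show "AE x in lborel. (\<lambda>n. f x - g n x) \<longlonglongrightarrow> 0"
    proof eventually_elim
      case (elim x)
      have "(\<lambda>n. clip (u n x)) \<longlonglongrightarrow> clip (f x)"
        using clip_cont u(2)[OF elim] by (intro continuous_on_tendsto_compose[OF clip_cont]) auto
      then have "(\<lambda>n. f x - g n x) \<longlonglongrightarrow> f x - \<phi> x *\<^sub>R clip (f x)"
        unfolding g_def by (intro tendsto_intros)
      then show ?case by (simp add: \<phi>f)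
    qed
    show "norm (f x - g n x) \<le> norm (indicator (cball 0 (R + 1)) x *\<^sub>R (2 * M))" for n x
    proof (cases "norm x \<le> R + 1")
      case True
      have "norm (g n x) \<le> 1 * M"
        unfolding g_def norm_scaleR using clip_bd M by (intro mult_mono) (auto simp: \<phi>_def)
      then have "norm (f x - g n x) \<le> M + M"
        using M(2)[of x] norm_triangle_ineq4[of "f x" "g n x"] by linarith
      then show ?thesis using True M by simp
    next
      case False
      then show ?thesis using R[of x] g0[of x n] by simp
    qed
    have "Lp_int p (\<lambda>x. indicator (cball (0::'a) (R + 1)) x *\<^sub>R (2 * M)) \<le>
        ennreal ((2 * M) powr p) * emeasure lborel (cball (0::'a) (R + 1))"
      using p M by (intro Lp_int_indicator_bound) auto
    also have "\<dots> < \<infinity>"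
      using emeasure_bounded_finite[of "cball (0::'a) (R + 1)"] by (simp add: ennreal_mult_less_top)
    finally show "Lp_int p (\<lambda>x. indicator (cball (0::'a) (R + 1)) x *\<^sub>R (2 * M)) < \<infinity>" .
    show "(\<lambda>x. indicator (cball 0 (R + 1)) x *\<^sub>R (2 * M)) \<in> borel_measurable borel"
      by (intro borel_measurable_scaleR borel_measurable_indicator) auto
  qed (use p in auto)
  then have "\<forall>\<^sub>F n in sequentially. Lp_int p (\<lambda>x. f x - g n x) < e"
    using e by (rule order_tendstoD)
  then obtain n where "Lp_int p (\<lambda>x. f x - g n x) < e"
    by (auto simp: eventually_sequentially)
  with g_cont g0 that show thesis by blast
qed

text \<open>Truncating \<open>f\<close> both in position and in size reduces to the bounded case;
  the truncations converge to \<open>f\<close> by dominated convergence with majorant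
  \<open>f\<close>.\<close>

lemma Lp_int_approx_continuous:
  fixes f :: "'a::euclidean_space \<Rightarrow> 'b::euclidean_space"
  assumes p: "1 \<le> p" and e: "0 < (e::real)" and [measurable]: "f \<in> borel_measurable borel"
    and fin: "Lp_int p f < \<infinity>"
  obtains g :: "'a \<Rightarrow> 'b" and R where "continuous_on UNIV g" "\<And>x. R < norm x \<Longrightarrow> g x = 0"
    "Lp_int p (\<lambda>x. f x - g x) \<le> ennreal e"
proof -
  define S where "S n = {x. norm x \<le> real n \<and> norm (f x) \<le> real n}" for n
  have [measurable]: "S n \<in> sets borel" for n
    unfolding S_def by measurable
  define t where "t n x = indicator (S n) x *\<^sub>R f x" for n x
  have [measurable]: "t n \<in> borel_measurable borel" for n
    unfolding t_def by measurable
  define e1 where "e1 = e / (2 * 2 powr p)"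
  have e1: "0 < e1" "2 powr p * (e1 + e1) = e"
    using e by (simp_all add: e1_def)
  have "(\<lambda>n. Lp_int p (\<lambda>x. f x - t n x)) \<longlonglongrightarrow> 0"
  proof (rule Lp_int_tendsto_0[where g = f])
    have "(\<lambda>n. f x - t n x) \<longlonglongrightarrow> 0" for x
    proof (rule tendsto_eventually)
      obtain N where "max (norm x) (norm (f x)) \<le> real N"
        using real_arch_simple by blast
      then show "\<forall>\<^sub>F n in sequentially. f x - t n x = 0"
        by (intro eventually_sequentiallyI[of N]) (auto simp: t_def S_def)
    qed
    then show "AE x in lborel. (\<lambda>n. f x - t n x) \<longlonglongrightarrow> 0" by simp
  qed (use p fin in \<open>auto simp: t_def indicator_def\<close>)
  then have "\<forall>\<^sub>F n in sequentially. Lp_int p (\<lambda>x. f x - t n x) < ennreal e1"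
    by (rule order_tendstoD) (use e1 in simp)
  then obtain n where n: "Lp_int p (\<lambda>x. f x - t n x) < ennreal e1"
    by (auto simp: eventually_sequentially)
  \<comment> \<open>The bound on the values is taken as \<open>real n + 1\<close> because it has to
    be positive and \<open>n\<close> may be 0.\<close>
  obtain g :: "'a \<Rightarrow> 'b" where g: "continuous_on UNIV g" "\<And>x. real n + 1 < norm x \<Longrightarrow> g x = 0"
    "Lp_int p (\<lambda>x. t n x - g x) < ennreal e1"
    by (rule Lp_int_approx_continuous_bounded[OF p, of "ennreal e1" "t n" "real n + 1" "real n"])
      (use e1 in \<open>auto simp: t_def S_def indicator_def\<close>)
  have [measurable]: "g \<in> borel_measurable borel"
    by (rule borel_measurable_continuous_onI[OF g(1)])
  have "Lp_int p (\<lambda>x. f x - g x) \<le>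
      ennreal (2 powr p) * (Lp_int p (\<lambda>x. f x - t n x) + Lp_int p (\<lambda>x. t n x - g x))"
    using p by (intro Lp_int_triangle) auto
  also have "\<dots> \<le> ennreal (2 powr p) * (ennreal e1 + ennreal e1)"
    using n g(3) by (intro mult_left_mono add_mono) auto
  also have "\<dots> = ennreal e"
    using e1 by (simp flip: ennreal_plus ennreal_mult)
  finally show thesis
    using g that[of g "real n + 1"] by blast
qed

text \<open>For |y| < 1 the difference vanishes outside the ball of radius \<open>R + 1\<close>, and
  for \<open>x\<close> in it both \<open>x\<close> and \<open>x + y\<close> lie in the compact ball
  of radius \<open>R + 2\<close>. Uniform continuity there gives a uniform bound on a set of finite
  measure.\<close>

lemma Lp_int_shift_continuous:
  fixes g :: "'a::euclidean_space \<Rightarrow> 'b::euclidean_space"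
  assumes p: "0 < p" and e: "0 < (e::real)"
    and g: "continuous_on UNIV g" "\<And>x. R < norm x \<Longrightarrow> g x = 0"
  shows "\<forall>\<^sub>F y in nhds 0. Lp_int p (\<lambda>x. g (x + y) - g x) \<le> ennreal e"
proof -
  define V where "V = measure lborel (cball (0::'a) (R + 1))"
  have V: "emeasure lborel (cball (0::'a) (R + 1)) = ennreal V"
    unfolding V_def
    by (rule emeasure_eq_ennreal_measure) (use emeasure_bounded_finite[of "cball (0::'a) (R + 1)"] in auto)
  have V0: "0 \<le> V" by (simp add: V_def)
  define \<eta> where "\<eta> = (e / (V + 1)) powr (1 / p)"
  have \<eta>: "0 < \<eta>" "\<eta> powr p * V \<le> e"
  proof -
    show "0 < \<eta>" using e V0 by (simp add: \<eta>_def)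
    have "\<eta> powr p = e / (V + 1)"
      using p e V0 by (simp add: \<eta>_def powr_powr)
    then show "\<eta> powr p * V \<le> e"
      using e V0 by (simp add: pos_divide_le_eq mult_left_mono)
  qed
  have "uniformly_continuous_on (cball 0 (R + 2)) g"
    by (rule compact_uniformly_continuous[OF continuous_on_subset[OF g(1)]]) auto
  then obtain \<delta> where \<delta>: "0 < \<delta>" "\<And>x x'. x \<in> cball 0 (R + 2) \<Longrightarrow> x' \<in> cball 0 (R + 2) \<Longrightarrow>
      dist x' x < \<delta> \<Longrightarrow> dist (g x') (g x) < \<eta>"
    using \<eta>(1) unfolding uniformly_continuous_on_def by metis
  have "Lp_int p (\<lambda>x. g (x + y) - g x) \<le> ennreal e" if y: "norm y < min 1 \<delta>" for y
  proof -
    have "Lp_int p (\<lambda>x. g (x + y) - g x) \<le> ennreal (\<eta> powr p) * emeasure lborel (cball (0::'a) (R + 1))"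
    proof (rule Lp_int_indicator_bound)
      fix x :: 'a
      have *: "norm (x + y) \<le> norm x + norm y" "norm x \<le> norm (x + y) + norm y"
        using norm_triangle_ineq[of x y] norm_triangle_ineq4[of "x + y" y] by auto
      show "norm (g (x + y) - g x) \<le> \<eta>" if "x \<in> cball 0 (R + 1)"
        using \<delta>(2)[of x "x + y"] that y * by (simp add: dist_norm flip: minus_add_distrib)
      show "g (x + y) - g x = 0" if "x \<notin> cball 0 (R + 1)"
        using g(2)[of x] g(2)[of "x + y"] that y * by auto
    qed (use p in auto)
    also have "\<dots> \<le> ennreal e"
      using \<eta> V0 by (simp add: V ennreal_leI flip: ennreal_mult)
    finally show ?thesis .
  qed
  then show ?thesis
    unfolding eventually_nhds_metric using \<delta>(1) by (intro exI[of _ "min 1 \<delta>"]) auto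
qed

text \<open>Go from the translate of \<open>f\<close> to that of \<open>g\<close>, then to
  \<open>g\<close>, then to \<open>f\<close>. By translation invariance the first distance equals
  the last.\<close>

lemma Lp_int_shift_le:
  fixes f g :: "'a::euclidean_space \<Rightarrow> 'b::euclidean_space"
  assumes p: "0 \<le> p"
    and [measurable]: "f \<in> borel_measurable borel" "g \<in> borel_measurable borel"
  shows "Lp_int p (\<lambda>x. f (x + y) - f x) \<le> ennreal (4 powr p) *
    (Lp_int p (\<lambda>x. f x - g x) + Lp_int p (\<lambda>x. g (x + y) - g x) + Lp_int p (\<lambda>x. f x - g x))"
  using Lp_int_triangle3[OF p, of "\<lambda>x. f (x + y)" "\<lambda>x. g (x + y)" g f]
    Lp_int_translate[of "\<lambda>x. f x - g x" p y]
  by (simp add: Lp_int_minus_commute[of p g])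

lemma Lp_int_shift:
  fixes f :: "'a::euclidean_space \<Rightarrow> 'b::euclidean_space"
  assumes p: "1 \<le> p" and e: "0 < (e::real)" and [measurable]: "f \<in> borel_measurable borel"
    and fin: "Lp_int p f < \<infinity>"
  shows "\<forall>\<^sub>F y in nhds 0. Lp_int p (\<lambda>x. f (x + y) - f x) \<le> ennreal e"
proof -
  define e1 where "e1 = e / (3 * 4 powr p)"
  have e1: "0 < e1" "4 powr p * (e1 + e1 + e1) = e"
    using e by (simp_all add: e1_def)
  obtain g R where g: "continuous_on UNIV g" "\<And>x. R < norm x \<Longrightarrow> g x = 0"
    "Lp_int p (\<lambda>x. f x - g x) \<le> ennreal e1"
    using Lp_int_approx_continuous[OF p e1(1) assms(3) fin] by metis
  have [measurable]: "g \<in> borel_measurable borel"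
    by (rule borel_measurable_continuous_onI[OF g(1)])
  have "\<forall>\<^sub>F y in nhds 0. Lp_int p (\<lambda>x. g (x + y) - g x) \<le> ennreal e1"
    using p g by (intro Lp_int_shift_continuous e1) auto
  then show ?thesis
  proof eventually_elim
    case (elim y)
    have "Lp_int p (\<lambda>x. f (x + y) - f x) \<le> ennreal (4 powr p) *
        (Lp_int p (\<lambda>x. f x - g x) + Lp_int p (\<lambda>x. g (x + y) - g x) + Lp_int p (\<lambda>x. f x - g x))"
      using p by (intro Lp_int_shift_le) auto
    also have "\<dots> \<le> ennreal (4 powr p) * (ennreal e1 + ennreal e1 + ennreal e1)"
      using elim g(3) by (intro mult_left_mono add_mono) auto
    also have "\<dots> = ennreal e"
      using e1 by (simp flip: ennreal_plus ennreal_mult)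
    finally show ?case .
  qed
qed

section \<open>From a finite net to uniform tails and translations\<close>

lemma equitight_of_totally_bounded:
  fixes h :: "'i \<Rightarrow> 'a::euclidean_space \<Rightarrow> 'b::euclidean_space"
  assumes p: "1 \<le> p" and e: "0 < e"
    and [measurable]: "\<And>i. h i \<in> borel_measurable borel"
    and fin: "\<And>i. i \<in> F \<Longrightarrow> Lp_int p (h i) < \<infinity>"
    and net: "\<And>e. 0 < e \<Longrightarrow>
      \<exists>K. finite K \<and> K \<subseteq> F \<and> (\<forall>i\<in>F. \<exists>j\<in>K. Lp_int p (\<lambda>x. h i x - h j x) \<le> ennreal e)"
  shows "\<exists>R. \<forall>i\<in>F. Lp_int p (\<lambda>x. indicator {x. norm x > R} x *\<^sub>R h i x) \<le> ennreal e"
proof -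
  define e1 where "e1 = e / (2 * 2 powr p)"
  have e1: "0 < e1" "2 powr p * (e1 + e1) = e"
    using e by (simp_all add: e1_def)
  obtain K where K: "finite K" "K \<subseteq> F" "\<And>i. i \<in> F \<Longrightarrow> \<exists>j\<in>K. Lp_int p (\<lambda>x. h i x - h j x) \<le> ennreal e1"
    using net[OF e1(1)] by blast
  \<comment> \<open>Each member of the net has small tails eventually; as \<open>K\<close> is
    finite, one radius serves them all.\<close>
  have "\<forall>j\<in>K. \<forall>\<^sub>F n in sequentially.
      Lp_int p (\<lambda>x. indicator {x. norm x > real n} x *\<^sub>R h j x) < ennreal e1"
  proof
    fix j assume "j \<in> K"
    then have "(\<lambda>n. Lp_int p (\<lambda>x. indicator {x. norm x > real n} x *\<^sub>R h j x)) \<longlonglongrightarrow> 0"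
      using K p fin by (intro Lp_int_tail_tendsto_0) auto
    then show "\<forall>\<^sub>F n in sequentially. Lp_int p (\<lambda>x. indicator {x. norm x > real n} x *\<^sub>R h j x) < ennreal e1"
      by (rule order_tendstoD) (use e1 in simp)
  qed
  then have "\<forall>\<^sub>F n in sequentially. \<forall>j\<in>K.
      Lp_int p (\<lambda>x. indicator {x. norm x > real n} x *\<^sub>R h j x) < ennreal e1"
    using K(1) by (simp add: eventually_ball_finite)
  then obtain n where n: "\<And>j. j \<in> K \<Longrightarrow>
      Lp_int p (\<lambda>x. indicator {x. norm x > real n} x *\<^sub>R h j x) < ennreal e1"
    by (auto simp: eventually_sequentially)
  let ?T = "\<lambda>f x. indicator {x. norm x > real n} x *\<^sub>R f x"
  have "Lp_int p (?T (h i)) \<le> ennreal e" if i: "i \<in> F" for i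
  proof -
    obtain j where j: "j \<in> K" "Lp_int p (\<lambda>x. h i x - h j x) \<le> ennreal e1"
      using K(3)[OF i] by blast
    have "Lp_int p (?T (h i)) \<le> ennreal (2 powr p) *
        (Lp_int p (\<lambda>x. ?T (h i) x - ?T (h j) x) + Lp_int p (?T (h j)))"
      using Lp_int_triangle[of p "?T (h i)" "?T (h j)" "\<lambda>x. 0"] p by simp
    \<comment> \<open>Passing to the tail does not increase the distance between two
      functions.\<close>
    also have "\<dots> \<le> ennreal (2 powr p) * (Lp_int p (\<lambda>x. h i x - h j x) + Lp_int p (?T (h j)))"
      using p by (intro mult_left_mono add_mono Lp_int_mono) (auto simp: indicator_def)
    also have "\<dots> \<le> ennreal (2 powr p) * (ennreal e1 + ennreal e1)"
      using j n by (intro mult_left_mono add_mono) (auto intro: less_imp_le)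
    also have "\<dots> = ennreal e"
      using e1 by (simp flip: ennreal_plus ennreal_mult)
    finally show ?thesis .
  qed
  then show ?thesis by blast
qed

lemma equicontinuous_of_totally_bounded:
  fixes h :: "'i \<Rightarrow> 'a::euclidean_space \<Rightarrow> 'b::euclidean_space"
  assumes p: "1 \<le> p" and e: "0 < e"
    and [measurable]: "\<And>i. h i \<in> borel_measurable borel"
    and fin: "\<And>i. i \<in> F \<Longrightarrow> Lp_int p (h i) < \<infinity>"
    and net: "\<And>e. 0 < e \<Longrightarrow>
      \<exists>K. finite K \<and> K \<subseteq> F \<and> (\<forall>i\<in>F. \<exists>j\<in>K. Lp_int p (\<lambda>x. h i x - h j x) \<le> ennreal e)"
  shows "\<exists>\<rho>>0. \<forall>i\<in>F. \<forall>y. norm y < \<rho> \<longrightarrow> Lp_int p (\<lambda>x. h i (x + y) - h i x) \<le> ennreal e"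
proof -
  define e1 where "e1 = e / (3 * 4 powr p)"
  have e1: "0 < e1" "4 powr p * (e1 + e1 + e1) = e"
    using e by (simp_all add: e1_def)
  obtain K where K: "finite K" "K \<subseteq> F" "\<And>i. i \<in> F \<Longrightarrow> \<exists>j\<in>K. Lp_int p (\<lambda>x. h i x - h j x) \<le> ennreal e1"
    using net[OF e1(1)] by blast
  \<comment> \<open>Finitely many neighbourhoods of 0 intersect in a neighbourhood of 0, which
    yields a common \<open>\<rho>\<close> for the whole net.\<close>
  have "\<forall>j\<in>K. \<forall>\<^sub>F y in nhds 0. Lp_int p (\<lambda>x. h j (x + y) - h j x) \<le> ennreal e1"
    using K p fin e1 by (intro ballI Lp_int_shift) auto
  then have "\<forall>\<^sub>F y in nhds 0. \<forall>j\<in>K. Lp_int p (\<lambda>x. h j (x + y) - h j x) \<le> ennreal e1"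
    using K(1) by (simp add: eventually_ball_finite)
  then obtain \<rho> where \<rho>: "0 < \<rho>" "\<And>j y. norm y < \<rho> \<Longrightarrow> j \<in> K \<Longrightarrow>
      Lp_int p (\<lambda>x. h j (x + y) - h j x) \<le> ennreal e1"
    by (auto simp: eventually_nhds_metric)
  have "Lp_int p (\<lambda>x. h i (x + y) - h i x) \<le> ennreal e" if i: "i \<in> F" and y: "norm y < \<rho>" for i y
  proof -
    obtain j where j: "j \<in> K" "Lp_int p (\<lambda>x. h i x - h j x) \<le> ennreal e1"
      using K(3)[OF i] by blast
    have "Lp_int p (\<lambda>x. h i (x + y) - h i x) \<le> ennreal (4 powr p) *
        (Lp_int p (\<lambda>x. h i x - h j x) + Lp_int p (\<lambda>x. h j (x + y) - h j x) + Lp_int p (\<lambda>x. h i x - h j x))"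
      using p by (intro Lp_int_shift_le) auto
    also have "\<dots> \<le> ennreal (4 powr p) * (ennreal e1 + ennreal e1 + ennreal e1)"
      using j \<rho>(2)[OF y j(1)] by (intro mult_left_mono add_mono) auto
    also have "\<dots> = ennreal e"
      using e1 by (simp flip: ennreal_plus ennreal_mult)
    finally show ?thesis .
  qed
  with \<rho>(1) show ?thesis by blast
qed

subsection \<open>Transfer to classes of measurable functions\<close>

text \<open>The coordinates are real-valued, and each agrees almost everywhere with a Borel
  function; reassembling them over the finite basis discards only a null set.\<close>

lemma ex_borel_representative:
  fixes f :: "'a::euclidean_space \<Rightarrow> 'b::euclidean_space"
  assumes [measurable]: "f \<in> borel_measurable lebesgue"
  shows "\<exists>g\<in>borel_measurable borel. AE x in lebesgue. f x = g x"
proof -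
  have "\<exists>g\<in>borel_measurable lborel. AE x in lborel. f x \<bullet> b = g x" for b
    by (intro completion_ex_borel_measurable_real) measurable
  then obtain g where g: "\<And>b. g b \<in> borel_measurable borel" "\<And>b. AE x in lborel. f x \<bullet> b = g b x"
    by (simp add: Bex_def) metis
  note [measurable] = g(1)
  have "AE x in lborel. \<forall>b\<in>Basis. f x \<bullet> b = g b x"
    using g(2) by (intro AE_finite_allI) auto
  then have "AE x in lborel. f x = (\<Sum>b\<in>Basis. g b x *\<^sub>R b)"
  proof eventually_elim
    case (elim x)
    have "f x = (\<Sum>b\<in>Basis. (f x \<bullet> b) *\<^sub>R b)"
      by (simp add: euclidean_representation)
    with elim show ?case by (simp cong: sum.cong)
  qed
  moreover have "(\<lambda>x. \<Sum>b\<in>Basis. g b x *\<^sub>R b) \<in> borel_measurable borel"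
    by measurable
  ultimately show ?thesis
    by (intro bexI AE_completion)
qed

text \<open>Finiteness ensures integrability, so the right-hand side is the true integral and not
  the default value 0.\<close>

lemma Lp_int_eq_lebesgue_integral:
  fixes f :: "'a::euclidean_space \<Rightarrow> 'b::euclidean_space"
  assumes [measurable]: "f \<in> borel_measurable borel" and "Lp_int p f < \<infinity>"
  shows "Lp_int p f = ennreal (LINT x|lebesgue. norm (f x) powr p)"
proof -
  have "integrable lborel (\<lambda>x. norm (f x) powr p)"
    using assms(2) by (simp add: integrable_iff_bounded Lp_int_def)
  then show ?thesis
    by (simp add: Lp_int_def integral_completion nn_integral_eq_integral)
qed

theorem theorem5:
  fixes p :: real
    and \<F> :: "('k::{real_normed_field, euclidean_space}, 'n::finite) ae_fun set"
  assumes "1 \<le> p" and "\<F> \<subseteq> Lp_space p"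
  shows "totally_bounded_in (Lp_space p) (Lp_dist p) \<F> \<longleftrightarrow>
    Metric_space.mbounded (Lp_space p) (Lp_dist p) \<F> \<and>
    (\<forall>\<epsilon>>0. \<exists>R. \<forall>f\<in>\<F>.
      (LINT x:{x. norm x > R}|lebesgue. norm (rep_ae_fun f x) powr p) < \<epsilon> powr p) \<and>
    (\<forall>\<epsilon>>0. \<exists>\<rho>>0. \<forall>f\<in>\<F>. \<forall>y. norm y < \<rho> \<longrightarrow>
      (LINT x|lebesgue. norm (rep_ae_fun f (x + y) - rep_ae_fun f x) powr p) < \<epsilon> powr p)"
proof -

  \<comment> \<open>Translation to Borel representatives\<close>
  note p = assms(1)
  interpret Lp: Metric_space "Lp_space p :: ('k, 'n) ae_fun set" "Lp_dist p"
    by (rule Metric_space_Lp[OF p])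
  obtain h :: "('k, 'n) ae_fun \<Rightarrow> real^'n \<Rightarrow> 'k"
    where h [measurable]: "\<And>f. h f \<in> borel_measurable borel"
      and rep: "\<And>f. AE x in lebesgue. rep_ae_fun f x = h f x"
    using ex_borel_representative[OF rep_ae_fun_measurable] by metis
  have hl [measurable]: "h f \<in> borel_measurable lebesgue" for f
    using measurable_completion[of "h f" lborel borel] by simp
  have fin: "Lp_int p (h f) < \<infinity>" if "f \<in> Lp_space p" for f
  proof -
    have "(\<integral>\<^sup>+x. ennreal (norm (rep_ae_fun f x) powr p) \<partial>lebesgue) < \<infinity>"
      using that by (simp add: Lp_space_def integrable_iff_bounded)
    also have "(\<integral>\<^sup>+x. ennreal (norm (rep_ae_fun f x) powr p) \<partial>lebesgue) =
        (\<integral>\<^sup>+x. ennreal (norm (h f x) powr p) \<partial>lebesgue)"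
      by (rule nn_integral_cong_AE) (use rep[of f] in eventually_elim, simp)
    finally show ?thesis
      by (simp add: Lp_int_def nn_integral_completion)
  qed
  have fin_diff: "Lp_int p (\<lambda>x. h f x - h g x) < \<infinity>" if "f \<in> Lp_space p" "g \<in> Lp_space p" for f g
    using Lp_int_triangle[of p "h f" "\<lambda>x. 0" "h g"] fin[OF that(1)] fin[OF that(2)] p
    by (auto simp: ennreal_mult_less_top elim!: order.strict_trans1)
  have dist: "Lp_int p (\<lambda>x. h f x - h g x) = ennreal (Lp_dist p f g powr p)"
    if "f \<in> Lp_space p" "g \<in> Lp_space p" for f g
  proof -
    have "AE x in lebesgue. rep_ae_fun f x - rep_ae_fun g x = h f x - h g x"
      using rep[of f] rep[of g] by eventually_elim simp
    then have "Lp_dist p f g = Lp_norm p (\<lambda>x. h f x - h g x)"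
      unfolding Lp_dist_def by (intro Lp_norm_cong_AE) auto
    then have "Lp_dist p f g powr p = (LINT x|lebesgue. norm (h f x - h g x) powr p)"
      using p by (simp add: Lp_norm_def powr_powr)
    then show ?thesis
      using Lp_int_eq_lebesgue_integral[OF _ fin_diff[OF that]] by simp
  qed
  have tail: "Lp_int p (\<lambda>x. indicator {x. norm x > R} x *\<^sub>R h f x) =
      ennreal (LINT x:{x. norm x > R}|lebesgue. norm (rep_ae_fun f x) powr p)"
    if "f \<in> Lp_space p" for f R
  proof -
    have "(LINT x:{x. norm x > R}|lebesgue. norm (rep_ae_fun f x) powr p) =
        (LINT x:{x. norm x > R}|lebesgue. norm (h f x) powr p)"
      by (rule tail_integral_cong_AE) (use rep in auto)
    \<comment> \<open>The indicator may move inside the power because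
      \<open>0 powr p = 0\<close>.\<close>
    also have "\<dots> = (LINT x|lebesgue. norm (indicator {x. norm x > R} x *\<^sub>R h f x) powr p)"
      unfolding set_lebesgue_integral_def
      by (rule Bochner_Integration.integral_cong) (auto simp: indicator_def)
    finally have "(LINT x:{x. norm x > R}|lebesgue. norm (rep_ae_fun f x) powr p) =
        (LINT x|lebesgue. norm (indicator {x. norm x > R} x *\<^sub>R h f x) powr p)" .
    moreover have "Lp_int p (\<lambda>x. indicator {x. norm x > R} x *\<^sub>R h f x) \<le> Lp_int p (h f)"
      using p by (intro Lp_int_mono) (auto simp: indicator_def)
    ultimately show ?thesis
      using fin[OF that] by (subst Lp_int_eq_lebesgue_integral) (auto elim: order.strict_trans1)
  qed
  have shift: "Lp_int p (\<lambda>x. h f (x + y) - h f x) =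
      ennreal (LINT x|lebesgue. norm (rep_ae_fun f (x + y) - rep_ae_fun f x) powr p)"
    if "f \<in> Lp_space p" for f y
  proof -
    have "(LINT x|lebesgue. norm (rep_ae_fun f (x + y) - rep_ae_fun f x) powr p) =
        (LINT x|lebesgue. norm (h f (x + y) - h f x) powr p)"
      by (rule translation_integral_cong_AE) (use rep in auto)
    moreover have "Lp_int p (\<lambda>x. h f (x + y) - h f x) < \<infinity>"
      using Lp_int_triangle[of p "\<lambda>x. h f (x + y)" "\<lambda>x. 0" "h f"] Lp_int_translate[OF h, of p f y]
        fin[OF that] p
      by (auto simp: ennreal_mult_less_top elim!: order.strict_trans1)
    ultimately show ?thesis
      by (subst Lp_int_eq_lebesgue_integral) auto
  qed
  \<comment> \<open>Aiming at half of \<open>e powr p\<close> turns the non-strict bounds on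
    \<open>Lp_int\<close> into the strict ones of the theorem.\<close>
  have LINT_less: "I < e powr p" if "ennreal I \<le> ennreal (e powr p / 2)" "0 < e" for e I :: real
  proof -
    have "0 < e powr p" "I \<le> e powr p / 2"
      using that by (simp_all add: ennreal_le_iff)
    then show ?thesis by linarith
  qed
  have F: "f \<in> Lp_space p" if "f \<in> \<F>" for f
    using assms(2) that by blast
  have root: "\<exists>e>0. e powr p = c" if "0 < c" for c :: real
    using that p by (intro exI[of _ "c powr (1 / p)"]) (simp add: powr_powr)
  show ?thesis
  proof

    \<comment> \<open>Necessity of the three conditions\<close>
    assume tb: "totally_bounded_in (Lp_space p) (Lp_dist p) \<F>"
    then have mtb: "Lp.mtotally_bounded \<F>"
      using Lp.totally_bounded_in_iff_mtotally_bounded[OF assms(2)] by simp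
    \<comment> \<open>\<open>mtotally_bounded\<close> places the centres inside the family, so that
      finiteness of the integrals is available for them. Radius and bound are related by
      \<open>e powr p = c\<close>.\<close>
    have net: "\<exists>K. finite K \<and> K \<subseteq> \<F> \<and> (\<forall>f\<in>\<F>. \<exists>g\<in>K. Lp_int p (\<lambda>x. h f x - h g x) \<le> ennreal c)"
      if "0 < c" for c
    proof -
      obtain e where e: "0 < e" "e powr p = c"
        using root[OF \<open>0 < c\<close>] by blast
      obtain K where K: "finite K" "K \<subseteq> \<F>" "\<F> \<subseteq> (\<Union>g\<in>K. Lp.mball g e)"
        using mtb[unfolded Lp.mtotally_bounded_def, rule_format, OF e(1)] by metis
      have "\<exists>g\<in>K. Lp_int p (\<lambda>x. h f x - h g x) \<le> ennreal c" if f: "f \<in> \<F>" for f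
      proof -
        obtain g where g: "g \<in> K" "Lp_dist p g f < e"
          using K(3) f by auto
        have "Lp_dist p f g powr p \<le> c"
          using g(2) p Lp.nonneg[of f g] unfolding e(2)[symmetric]
          by (intro powr_mono2) (auto simp: Lp.commute)
        then show ?thesis
          using g(1) K(2) F f by (intro bexI[of _ g]) (auto simp: dist ennreal_leI)
      qed
      with K show ?thesis by blast
    qed
    show "Lp.mbounded \<F> \<and>
      (\<forall>\<epsilon>>0. \<exists>R. \<forall>f\<in>\<F>.
        (LINT x:{x. norm x > R}|lebesgue. norm (rep_ae_fun f x) powr p) < \<epsilon> powr p) \<and>
      (\<forall>\<epsilon>>0. \<exists>\<rho>>0. \<forall>f\<in>\<F>. \<forall>y. norm y < \<rho> \<longrightarrow>
        (LINT x|lebesgue. norm (rep_ae_fun f (x + y) - rep_ae_fun f x) powr p) < \<epsilon> powr p)"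
    proof (intro conjI allI impI)
      show "Lp.mbounded \<F>"
        using mtb by (rule Lp.mtotally_bounded_imp_mbounded)
    next
      fix e :: real assume e: "0 < e"
      then obtain R where "\<And>f. f \<in> \<F> \<Longrightarrow>
          Lp_int p (\<lambda>x. indicator {x. norm x > R} x *\<^sub>R h f x) \<le> ennreal (e powr p / 2)"
        using equitight_of_totally_bounded[OF p _ h fin[OF F] net, of "e powr p / 2"] by auto
      then show "\<exists>R. \<forall>f\<in>\<F>.
          (LINT x:{x. norm x > R}|lebesgue. norm (rep_ae_fun f x) powr p) < e powr p"
        using F tail e by (intro exI[of _ R] ballI LINT_less) auto
    next
      fix e :: real assume e: "0 < e"
      then obtain \<rho> where "0 < \<rho>" "\<And>f y. f \<in> \<F> \<Longrightarrow> norm y < \<rho> \<Longrightarrow>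
          Lp_int p (\<lambda>x. h f (x + y) - h f x) \<le> ennreal (e powr p / 2)"
        using equicontinuous_of_totally_bounded[OF p _ h fin[OF F] net, of "e powr p / 2"] by auto
      then show "\<exists>\<rho>>0. \<forall>f\<in>\<F>. \<forall>y. norm y < \<rho> \<longrightarrow>
          (LINT x|lebesgue. norm (rep_ae_fun f (x + y) - rep_ae_fun f x) powr p) < e powr p"
        using F shift e by (intro exI[of _ \<rho>] conjI ballI allI impI LINT_less) auto
    qed
  next

    \<comment> \<open>Sufficiency of the three conditions\<close>
    assume "Lp.mbounded \<F> \<and>
      (\<forall>\<epsilon>>0. \<exists>R. \<forall>f\<in>\<F>.
        (LINT x:{x. norm x > R}|lebesgue. norm (rep_ae_fun f x) powr p) < \<epsilon> powr p) \<and>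
      (\<forall>\<epsilon>>0. \<exists>\<rho>>0. \<forall>f\<in>\<F>. \<forall>y. norm y < \<rho> \<longrightarrow>
        (LINT x|lebesgue. norm (rep_ae_fun f (x + y) - rep_ae_fun f x) powr p) < \<epsilon> powr p)"
    then have bd: "Lp.mbounded \<F>" and tl: "\<And>e. 0 < e \<Longrightarrow> \<exists>R. \<forall>f\<in>\<F>.
        (LINT x:{x. norm x > R}|lebesgue. norm (rep_ae_fun f x) powr p) < e powr p"
      and sh: "\<And>e. 0 < e \<Longrightarrow> \<exists>\<rho>>0. \<forall>f\<in>\<F>. \<forall>y. norm y < \<rho> \<longrightarrow>
        (LINT x|lebesgue. norm (rep_ae_fun f (x + y) - rep_ae_fun f x) powr p) < e powr p"
      by simp_all
    have tails: "\<exists>R. \<forall>f\<in>\<F>. Lp_int p (\<lambda>x. indicator {x. norm x > R} x *\<^sub>R h f x) \<le> ennreal c"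
      if "0 < c" for c
    proof -
      obtain e where e: "0 < e" "e powr p = c"
        using root[OF \<open>0 < c\<close>] by blast
      obtain r where "\<And>f. f \<in> \<F> \<Longrightarrow>
          (LINT x:{x. norm x > r}|lebesgue. norm (rep_ae_fun f x) powr p) < c"
        using tl[OF e(1)] unfolding e(2) by blast
      then show ?thesis
        using F by (intro exI[of _ r]) (auto simp: tail intro!: ennreal_leI[OF less_imp_le])
    qed
    have shifts: "\<exists>\<rho>>0. \<forall>f\<in>\<F>. \<forall>y. norm y < \<rho> \<longrightarrow> Lp_int p (\<lambda>x. h f (x + y) - h f x) \<le> ennreal c"
      if "0 < c" for c
    proof -
      obtain e where e: "0 < e" "e powr p = c"
        using root[OF \<open>0 < c\<close>] by blast
      obtain \<rho> where "0 < \<rho>" "\<And>f y. f \<in> \<F> \<Longrightarrow> norm y < \<rho> \<Longrightarrow>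
          (LINT x|lebesgue. norm (rep_ae_fun f (x + y) - rep_ae_fun f x) powr p) < c"
        using sh[OF e(1)] unfolding e(2) by blast
      then show ?thesis
        using F by (intro exI[of _ \<rho>]) (auto simp: shift intro!: ennreal_leI[OF less_imp_le])
    qed
    \<comment> \<open>Boundedness in the metric gives a ball around some \<open>a\<close>, not
      necessarily around 0, so the integral \<open>A\<close> of the centre enters. That
      \<open>a\<close> lies in the space follows from \<open>f\<close> being in its ball.\<close>
    have "\<exists>B. \<forall>f\<in>\<F>. Lp_int p (h f) \<le> ennreal B"
    proof -
      obtain a B where aB: "\<F> \<subseteq> Lp.mcball a B"
        using bd unfolding Lp.mbounded_def by blast
      define A where "A = (LINT x|lebesgue. norm (h a x) powr p)"
      have "Lp_int p (h f) \<le> ennreal (2 powr p * (B powr p + A))" if f: "f \<in> \<F>" for f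
      proof -
        have a: "a \<in> Lp_space p" "Lp_dist p a f \<le> B"
          using aB f by auto
        then have "Lp_dist p f a powr p \<le> B powr p"
          using p Lp.nonneg[of f a] by (intro powr_mono2) (auto simp: Lp.commute)
        then have "Lp_int p (\<lambda>x. h f x - h a x) \<le> ennreal (B powr p)"
          using F f a by (simp add: dist ennreal_leI)
        moreover have "Lp_int p (h a) = ennreal A"
          unfolding A_def using Lp_int_eq_lebesgue_integral[OF h fin[OF a(1)]] .
        moreover have "Lp_int p (h f) \<le> ennreal (2 powr p) * (Lp_int p (\<lambda>x. h f x - h a x) + Lp_int p (h a))"
          using Lp_int_triangle[of p "h f" "h a" "\<lambda>x. 0"] p by simp
        ultimately have "Lp_int p (h f) \<le> ennreal (2 powr p) * (ennreal (B powr p) + ennreal A)"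
          by (elim order_trans) (intro mult_left_mono add_mono, auto)
        then show ?thesis
          by (simp add: A_def flip: ennreal_plus ennreal_mult)
      qed
      then show ?thesis by blast
    qed
    then obtain B where B: "\<And>f. f \<in> \<F> \<Longrightarrow> Lp_int p (h f) \<le> ennreal B"
      by blast
    show "totally_bounded_in (Lp_space p) (Lp_dist p) \<F>"
      unfolding totally_bounded_in_def
    proof (intro allI impI)
      fix e :: real assume e: "0 < e"
      have "\<exists>\<U>. finite \<U> \<and> \<F> \<subseteq> \<Union>\<U> \<and> (\<forall>U\<in>\<U>. U \<subseteq> \<F> \<and>
          (\<forall>f\<in>U. \<forall>g\<in>U. Lp_int p (\<lambda>x. h f x - h g x) \<le> ennreal (e powr p)))"
        by (rule totally_bounded_of_samples[OF p _ h B tails shifts]) (use e in auto)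
      then obtain \<U> where U: "finite \<U>" "\<F> \<subseteq> \<Union>\<U>" "\<forall>U\<in>\<U>. U \<subseteq> \<F> \<and>
          (\<forall>f\<in>U. \<forall>g\<in>U. Lp_int p (\<lambda>x. h f x - h g x) \<le> ennreal (e powr p))"
        by (elim exE conjE)
      have "Lp_dist p f g \<le> e" if "U \<in> \<U>" "f \<in> U" "g \<in> U" for U f g
      proof -
        have "f \<in> Lp_space p" "g \<in> Lp_space p"
          using bspec[OF U(3) that(1)] that F by blast+
        moreover have "Lp_int p (\<lambda>x. h f x - h g x) \<le> ennreal (e powr p)"
          using bspec[OF U(3) that(1)] that by blast
        ultimately have "Lp_dist p f g powr p \<le> e powr p"
          by (simp add: dist)
        \<comment> \<open>Strict monotonicity of the power on nonnegative reals, used in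
          contrapositive form, removes the exponent.\<close>
        then show ?thesis
          using powr_less_mono2[of p e "Lp_dist p f g"] p e by force
      qed
      then show "\<exists>\<U>. finite \<U> \<and> \<F> \<subseteq> \<Union>\<U> \<and>
          (\<forall>U\<in>\<U>. U \<subseteq> Lp_space p \<and> (\<forall>f\<in>U. \<forall>g\<in>U. Lp_dist p f g \<le> e))"
        using U assms(2) by (intro exI[of _ \<U>]) (simp add: subset_trans[OF _ assms(2)])
    qed
  qed
qed

end
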